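(* For every chord diagram $D$, \[ W(\psi(D))=W(D)\big|_{c=0}, \] i.e. the deframed universal weight system $\overline W=W\circ\psi$ is obtained by evaluating the polynomial $W(D)\in\mathbb C[h,c]$ at $c=0$; in particular $\overline W(D)\in\mathbb C[h]$.
   Context: Let $\mathfrak g=gl(1|1)$ be the Lie superalgebra with homogeneous basis $H,G$ (even) and $Q_+,Q_-$ (odd) (the matrices $H=I$, $G=\mathrm{diag}(0,1)$, $Q_+=E_{21}$, $Q_-=E_{12}$ acting on $\mathbb C^{1|1}$), whose nonzero supercommutators of basis elements are $[G,Q_\pm]=\pm Q_\pm$, $[Q_+,Q_-]=H$ and those obtained from these by super-antisymmetry. Equip $\mathfrak g$ with the even, supersymmetric, invariant, nondegenerate bilinear form with $\langle Q_+,Q_-\rangle=1=-\langle Q_-,Q_+\rangle$, $\langle H,G\rangle=\langle G,H\rangle=1$ and all other pairings of basis elements zero. Write $\{e_i\}$ for this basis and $(C^{ij})$ for the inverse of the Gram matrix, so that $C=\sum_{i,j}C^{ij}e_i\otimes e_j=G\otimes H+H\otimes G+Q_-\otimes Q_+-Q_+\otimes Q_-$. Let $U=U(\mathfrak g)$, $h\in U$ the image of $H$, and $c=\sum C^{ij}e_ie_j\in U$. The centre of $U$ is the polynomial algebra $\mathbb C[h,c]$. A chord diagram of order $n$ is an oriented circle together with $n$ pairwise disjoint unordered pairs of distinct points on it (chords), up to orientation-preserving diffeomorphism. The universal $gl(1|1)$ weight system: cut the circle at a point that is not an endpoint, number the $2n$ endpoints $1,\dots,2n$ following the orientation, let the $k$-th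 chord have endpoints $p_k<q_k$, and set $W(D)=\sum \big(\prod_{k}C^{i_kj_k}\big)\,\epsilon\,x_1\cdots x_{2n}\in U$, summed over all indices, where $x_{p_k}=e_{i_k}$, $x_{q_k}=e_{j_k}$, and $\epsilon$ is the Koszul sign (a factor $-1$ per transposition of two odd elements) of the rearrangement of $e_{i_1}e_{j_1}\cdots e_{i_n}e_{j_n}$ into $x_1\cdots x_{2n}$. $W(D)$ is independent of the cut and lies in $\mathbb C[h,c]$; $W(\emptyset)=1$. Let $\mathcal A$ be the vector space of formal linear combinations of chord diagrams modulo the four-term relations; it is a commutative algebra under connected sum of diagrams, and $W$ extends linearly to an algebra homomorphism $\mathcal A\to\mathbb C[h,c]$. Let $\Theta$ be the chord diagram with one chord (so $W(\Theta)=c$). Define $s(D)=\sum_a (D\setminus\{a\})$ over all chords $a$ of $D$ for nonempty $D$, $s(\emptyset)=0$, extended linearly, and $\psi(D)=\sum_{k\ge0}\frac{(-1)^k}{k!}\Theta^k\cdot s^k(D)$ (a finite sum), where $\cdot$ is connected sum. *)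

theory Defs
  imports "HOL-Computational_Algebra.Polynomial"
begin

datatype gb = H | G | Qp | Qm

fun godd :: "gb \<Rightarrow> bool" where
  "godd H = False" | "godd G = False" | "godd Qp = True" | "godd Qm = True"

text \<open>Elements of the tensor algebra T(g): coefficient functions on words of basis
  elements (only finitely supported ones are ever produced below).\<close>
type_synonym tens = "gb list \<Rightarrow> complex"

definition tzero :: tens where "tzero = (\<lambda>w. 0)"
definition tadd :: "tens \<Rightarrow> tens \<Rightarrow> tens" where "tadd a b = (\<lambda>w. a w + b w)"
definition tscale :: "complex \<Rightarrow> tens \<Rightarrow> tens" where "tscale k a = (\<lambda>w. k * a w)"
definition tmono :: "gb list \<Rightarrow> tens" where "tmono u = (\<lambda>w. if w = u then 1 else 0)"
definition tmult :: "tens \<Rightarrow> tens \<Rightarrow> tens" where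
  "tmult a b = (\<lambda>w. \<Sum>i\<le>length w. a (take i w) * b (drop i w))"
fun tpow :: "tens \<Rightarrow> nat \<Rightarrow> tens" where
  "tpow a 0 = tmono []" | "tpow a (Suc n) = tmult a (tpow a n)"
definition tsumset :: "('x \<Rightarrow> tens) \<Rightarrow> 'x set \<Rightarrow> tens" where
  "tsumset f A = (\<lambda>w. \<Sum>x\<in>A. f x w)"

fun brk :: "gb \<Rightarrow> gb \<Rightarrow> tens" where
  "brk G Qp = tmono [Qp]"
| "brk G Qm = tscale (-1) (tmono [Qm])"
| "brk Qp G = tscale (-1) (tmono [Qp])"
| "brk Qm G = tmono [Qm]"
| "brk Qp Qm = tmono [H]"
| "brk Qm Qp = tmono [H]"
| "brk _ _ = tzero"

definition ksign :: "gb \<Rightarrow> gb \<Rightarrow> complex" where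
  "ksign x y = (if godd x \<and> godd y then -1 else 1)"

definition urel :: "gb \<Rightarrow> gb \<Rightarrow> tens" where
  "urel x y = tadd (tmono [x, y]) (tadd (tscale (- ksign x y) (tmono [y, x])) (tscale (-1) (brk x y)))"

inductive_set uideal :: "tens set" where
  "tzero \<in> uideal"
| "a \<in> uideal \<Longrightarrow> b \<in> uideal \<Longrightarrow> tadd a b \<in> uideal"
| "tscale k (tmult (tmono u) (tmult (urel x y) (tmono v))) \<in> uideal"

text \<open>Equality in U(g) = T(g)/uideal.\<close>
definition ueq :: "tens \<Rightarrow> tens \<Rightarrow> bool" where
  "ueq a b \<longleftrightarrow> tadd a (tscale (-1) b) \<in> uideal"

text \<open>Inverse Gram matrix C^{ij}: C = G(x)H + H(x)G + Q-(x)Q+ - Q+(x)Q-.\<close>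
fun Cc :: "gb \<Rightarrow> gb \<Rightarrow> complex" where
  "Cc G H = 1" | "Cc H G = 1" | "Cc Qm Qp = 1" | "Cc Qp Qm = -1" | "Cc _ _ = 0"

definition hU :: tens where "hU = tmono [H]"
definition cU :: tens where "cU = (\<lambda>w. case w of [x, y] \<Rightarrow> Cc x y | _ \<Rightarrow> 0)"

definition evh :: "complex poly \<Rightarrow> tens" where
  "evh q = tsumset (\<lambda>j. tscale (coeff q j) (tpow hU j)) {..degree q}"
definition evhc :: "complex poly poly \<Rightarrow> tens" where
  "evhc p = tsumset (\<lambda>i. tmult (evh (coeff p i)) (tpow cU i)) {..degree p}"

text \<open>A chord diagram cut at a point: a word of chord labels, each appearing exactly twice.\<close>
definition chord_word :: "nat list \<Rightarrow> bool" where
  "chord_word w \<longleftrightarrow> (\<forall>x\<in>set w. count_list w x = 2)"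

definition chord_pairs :: "nat list \<Rightarrow> (nat \<times> nat) set" where
  "chord_pairs w = {(a, b). a < b \<and> b < length w \<and> w ! a = w ! b}"

definition kflag :: "nat list \<Rightarrow> nat \<Rightarrow> nat" where
  "kflag w a = (if \<exists>b<a. w ! b = w ! a then 1 else 0)"

text \<open>Position b comes before position a in the canonical order e_{i1} e_{j1} ... e_{in} e_{jn}.\<close>
definition kless :: "nat list \<Rightarrow> nat \<Rightarrow> nat \<Rightarrow> bool" where
  "kless w b a \<longleftrightarrow> w ! b < w ! a \<or> (w ! b = w ! a \<and> kflag w b < kflag w a)"

definition koszul :: "nat list \<Rightarrow> gb list \<Rightarrow> complex" where
  "koszul w l = (-1) ^ card {(a, b). a < b \<and> b < length w \<and> godd (l ! a) \<and> godd (l ! b) \<and> kless w b a}"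

text \<open>Universal gl(1|1) weight system (as a representative in T(g)).\<close>
definition Wt :: "nat list \<Rightarrow> tens" where
  "Wt w = tsumset
     (\<lambda>l. tscale ((\<Prod>(a, b)\<in>chord_pairs w. Cc (l ! a) (l ! b)) * koszul w l) (tmono l))
     (set (List.n_lists (length w) [H, G, Qp, Qm]))"

type_synonym lcomb = "(complex \<times> nat list) list"

definition sdiag :: "nat list \<Rightarrow> lcomb" where
  "sdiag w = map (\<lambda>x. (1, filter (\<lambda>y. y \<noteq> x) w)) (remdups w)"

definition slin :: "lcomb \<Rightarrow> lcomb" where
  "slin L = concat (map (\<lambda>(k, w). map (\<lambda>(k', w'). (k * k', w')) (sdiag w)) L)"

text \<open>Connected sum with Theta^k (k isolated chords), at the cut point.\<close>
definition theta_sum :: "nat \<Rightarrow> nat list \<Rightarrow> nat list" where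
  "theta_sum k w = concat (map (\<lambda>i. [i, i]) [0..<k]) @ map (\<lambda>x. x + k) w"

definition psi :: "nat list \<Rightarrow> lcomb" where
  "psi w = concat (map (\<lambda>k. map (\<lambda>(a, v). ((-1) ^ k / fact k * a, theta_sum k v))
                               ((slin ^^ k) [(1, w)]))
                       [0..<Suc (length w)])"

definition WL :: "lcomb \<Rightarrow> tens" where
  "WL L = foldr (\<lambda>(a, w) acc. tadd (tscale a (Wt w)) acc) L tzero"

end

theory Submission
  imports Defs
begin

text \<open>
  \<open>U\<close> is embedded into the \<open>2 \<times> 2\<close> matrices over \<open>\<complex>[a][b]\<close> by the generic
  two-dimensional representation \<open>H \<mapsto> a\<close>, \<open>G \<mapsto> diag(b, b + 1)\<close>, in which \<open>c\<close> acts by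
  the scalar \<open>a(2b + 1)\<close>. The centre of \<open>U\<close> is larger than \<open>\<complex>[h, c]\<close>
  (it contains, for instance, an element acting by the scalar \<open>a(2b + 1)\<^sup>2\<close>), so
  centrality alone does not give \<open>W(D) \<in> \<complex>[h, c]\<close>. What does is that in every
  word occurring in \<open>W(D)\<close> the letters \<open>G\<close> are matched with letters \<open>H\<close>: hence
  \<open>W(D)\<close> acts by \<open>a\<^sup>n F(b)\<close> with \<open>deg F \<le> n\<close>, and \<open>a, ab\<close> are polynomials in the
  scalars of \<open>h\<close> and \<open>c\<close>. Differentiating in \<open>b\<close> replaces one chord at a time by \<open>2a\<close>,
  so the operator \<open>2a s\<close> corresponds to \<open>d/db\<close>, and \<open>W(\<psi>(D))\<close> becomes the Taylor expansion
  of \<open>W(D)\<close> with increment \<open>-(b + 1/2)\<close>, i.e. the value at \<open>b = -1/2\<close>, where \<open>c\<close> vanishes.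
\<close>

section \<open>Evaluation in the generic two-dimensional representation\<close>

datatype 'a m2 = M2 (e11: 'a) (e12: 'a) (e21: 'a) (e22: 'a)

instantiation m2 :: (comm_ring_1) ring_1
begin

definition zero_m2 :: "'a m2" where "0 = M2 0 0 0 0"
definition one_m2 :: "'a m2" where "1 = M2 1 0 0 1"
definition plus_m2 :: "'a m2 \<Rightarrow> 'a m2 \<Rightarrow> 'a m2" where
  "x + y = M2 (e11 x + e11 y) (e12 x + e12 y) (e21 x + e21 y) (e22 x + e22 y)"
definition minus_m2 :: "'a m2 \<Rightarrow> 'a m2 \<Rightarrow> 'a m2" where
  "x - y = M2 (e11 x - e11 y) (e12 x - e12 y) (e21 x - e21 y) (e22 x - e22 y)"
definition uminus_m2 :: "'a m2 \<Rightarrow> 'a m2" where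
  "- x = M2 (- e11 x) (- e12 x) (- e21 x) (- e22 x)"
definition times_m2 :: "'a m2 \<Rightarrow> 'a m2 \<Rightarrow> 'a m2" where
  "x * y = M2 (e11 x * e11 y + e12 x * e21 y) (e11 x * e12 y + e12 x * e22 y)
              (e21 x * e11 y + e22 x * e21 y) (e21 x * e12 y + e22 x * e22 y)"

instance
  by standard
    (simp_all add: zero_m2_def one_m2_def plus_m2_def minus_m2_def uminus_m2_def times_m2_def
      algebra_simps m2.expand)

end

lemma m2_sel [simp]:
  "e11 0 = 0" "e12 0 = 0" "e21 0 = 0" "e22 0 = 0"
  "e11 1 = 1" "e12 1 = 0" "e21 1 = 0" "e22 1 = 1"
  "e11 (x + y) = e11 x + e11 y" "e12 (x + y) = e12 x + e12 y"
  "e21 (x + y) = e21 x + e21 y" "e22 (x + y) = e22 x + e22 y"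
  "e11 (x - y) = e11 x - e11 y" "e12 (x - y) = e12 x - e12 y"
  "e21 (x - y) = e21 x - e21 y" "e22 (x - y) = e22 x - e22 y"
  "e11 (- x) = - e11 x" "e12 (- x) = - e12 x" "e21 (- x) = - e21 x" "e22 (- x) = - e22 x"
  "e11 (x * y) = e11 x * e11 y + e12 x * e21 y" "e12 (x * y) = e11 x * e12 y + e12 x * e22 y"
  "e21 (x * y) = e21 x * e11 y + e22 x * e21 y" "e22 (x * y) = e21 x * e12 y + e22 x * e22 y"
  by (simp_all add: zero_m2_def one_m2_def plus_m2_def minus_m2_def uminus_m2_def times_m2_def)

lemma m2_eq_iff: "x = y \<longleftrightarrow> e11 x = e11 y \<and> e12 x = e12 y \<and> e21 x = e21 y \<and> e22 x = e22 y"
  by (auto intro: m2.expand)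

lemma m2_sel_sum [simp]:
  "e11 (sum f A) = (\<Sum>i\<in>A. e11 (f i))" "e12 (sum f A) = (\<Sum>i\<in>A. e12 (f i))"
  "e21 (sum f A) = (\<Sum>i\<in>A. e21 (f i))" "e22 (sum f A) = (\<Sum>i\<in>A. e22 (f i))"
  by (induction A rule: infinite_finite_induct) auto

definition sc :: "'a::comm_ring_1 \<Rightarrow> 'a m2" where "sc r = M2 r 0 0 r"

lemma sc_sel [simp]: "e11 (sc r) = r" "e12 (sc r) = 0" "e21 (sc r) = 0" "e22 (sc r) = r"
  by (simp_all add: sc_def)

lemma sc_hom: "sc (r + s) = sc r + sc s" "sc (r * s) = sc r * sc s" "sc (- r) = - sc r"
  "sc 0 = 0" "sc 1 = 1"
  by (simp_all add: m2_eq_iff)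

lemma sc_power: "sc (r ^ n) = sc r ^ n"
  by (induction n) (simp_all add: sc_hom)

lemma sc_sum: "sc (sum f A) = (\<Sum>i\<in>A. sc (f i))"
  by (induction A rule: infinite_finite_induct) (simp_all add: sc_hom)

lemma sc_commute: "m * sc r = sc r * m"
  by (simp add: m2_eq_iff mult.commute)

lemma sc_left_commute: "m * (sc r * n) = sc r * (m * n)"
  by (metis mult.assoc sc_commute)

definition scal :: "complex \<Rightarrow> complex poly poly m2" where "scal k = sc [:[:k:]:]"

lemma scal_hom: "scal (r + s) = scal r + scal s" "scal (r * s) = scal r * scal s"
  "scal (- r) = - scal r" "scal 0 = 0" "scal 1 = 1"
  by (simp_all add: m2_eq_iff scal_def pCons_one)

lemma scal_left_commute: "m * (scal r * n) = scal r * (m * n)"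
  by (simp add: scal_def sc_left_commute)

text \<open>The inner polynomial variable is a and the outer one is b, so \<open>pderiv\<close>
  differentiates in b and treats \<open>va\<close> as a constant.\<close>

definition va :: "complex poly poly" where "va = [:[:0, 1:]:]"
definition vb :: "complex poly poly" where "vb = [:0, 1:]"

text \<open>The bracket of \<open>Qp\<close> and \<open>Qm\<close> forces the product of their
  off-diagonal entries to be a. Putting all of it into \<open>Qm\<close> keeps the entries
  polynomial and makes \<open>Qm\<close> count as one factor a in
  \<open>weight_bound_repw\<close>.\<close>

fun rep :: "gb \<Rightarrow> complex poly poly m2" where
  "rep H = M2 va 0 0 va"
| "rep G = M2 vb 0 0 (vb + 1)"
| "rep Qp = M2 0 0 1 0"
| "rep Qm = M2 0 va 0 0"

definition repw :: "gb list \<Rightarrow> complex poly poly m2" where "repw u = prod_list (map rep u)"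

lemma repw_simps [simp]: "repw [] = 1" "repw (x # u) = rep x * repw u"
  "repw (u @ v) = repw u * repw v"
  by (simp_all add: repw_def)

section \<open>Evaluation of finitely supported tensors\<close>

definition fsupp :: "tens \<Rightarrow> bool" where "fsupp t \<longleftrightarrow> finite {u. t u \<noteq> 0}"

text \<open>A sum over an infinite set is 0 by convention, so the laws for \<open>ev\<close> are
  stated for tensors with \<open>fsupp\<close>.\<close>

definition ev :: "tens \<Rightarrow> complex poly poly m2" where
  "ev t = (\<Sum>u | t u \<noteq> 0. scal (t u) * repw u)"

lemma ev_superset:
  assumes "finite A" "{u. t u \<noteq> 0} \<subseteq> A"
  shows "ev t = (\<Sum>u\<in>A. scal (t u) * repw u)"
  unfolding ev_def by (rule sum.mono_neutral_left) (use assms in \<open>auto simp: scal_hom\<close>)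

lemma fsupp_tzero [simp]: "fsupp tzero"
  by (simp add: fsupp_def tzero_def)

lemma fsupp_tmono [simp]: "fsupp (tmono u)"
  by (simp add: fsupp_def tmono_def)

lemma fsupp_tadd [simp]: "fsupp a \<Longrightarrow> fsupp b \<Longrightarrow> fsupp (tadd a b)"
  unfolding fsupp_def tadd_def
  by (rule finite_subset[of _ "{u. a u \<noteq> 0} \<union> {u. b u \<noteq> 0}"]) auto

lemma fsupp_tscale [simp]: "fsupp a \<Longrightarrow> fsupp (tscale k a)"
  unfolding fsupp_def tscale_def by (rule finite_subset[of _ "{u. a u \<noteq> 0}"]) auto

lemma fsupp_tsumset:
  assumes "finite A" "\<And>x. x \<in> A \<Longrightarrow> fsupp (f x)"
  shows "fsupp (tsumset f A)"
proof -
  have "{u. tsumset f A u \<noteq> 0} \<subseteq> (\<Union>x\<in>A. {u. f x u \<noteq> 0})"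
    by (auto simp: tsumset_def elim: contrapos_np intro!: sum.neutral)
  then show ?thesis using assms unfolding fsupp_def by (meson finite_UN_I finite_subset)
qed

lemma ev_tzero [simp]: "ev tzero = 0"
  by (simp add: ev_def tzero_def)

lemma ev_tmono [simp]: "ev (tmono u) = repw u"
  by (simp add: ev_def tmono_def scal_hom)

lemma ev_tadd [simp]:
  assumes "fsupp a" "fsupp b"
  shows "ev (tadd a b) = ev a + ev b"
proof -
  let ?A = "{u. a u \<noteq> 0} \<union> {u. b u \<noteq> 0}"
  have fin: "finite ?A" using assms by (simp add: fsupp_def)
  have "ev (tadd a b) = (\<Sum>u\<in>?A. scal (tadd a b u) * repw u)"
    by (rule ev_superset[OF fin]) (auto simp: tadd_def)
  also have "\<dots> = (\<Sum>u\<in>?A. scal (a u) * repw u) + (\<Sum>u\<in>?A. scal (b u) * repw u)"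
    by (simp add: tadd_def scal_hom distrib_right sum.distrib)
  also have "(\<Sum>u\<in>?A. scal (a u) * repw u) = ev a" by (rule ev_superset[OF fin, symmetric]) auto
  also have "(\<Sum>u\<in>?A. scal (b u) * repw u) = ev b" by (rule ev_superset[OF fin, symmetric]) auto
  finally show ?thesis .
qed

lemma ev_tscale [simp]:
  assumes "fsupp a"
  shows "ev (tscale k a) = scal k * ev a"
proof -
  have "ev (tscale k a) = (\<Sum>u | a u \<noteq> 0. scal (tscale k a u) * repw u)"
    by (rule ev_superset) (use assms in \<open>auto simp: tscale_def fsupp_def\<close>)
  then show ?thesis by (simp add: ev_def tscale_def scal_hom sum_distrib_left mult.assoc)
qed

lemma tsumset_empty: "tsumset f {} = tzero"
  by (simp add: tsumset_def tzero_def)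

lemma tsumset_insert: "finite A \<Longrightarrow> x \<notin> A \<Longrightarrow> tsumset f (insert x A) = tadd (f x) (tsumset f A)"
  by (simp add: tsumset_def tadd_def)

lemma ev_tsumset:
  assumes "finite A" "\<And>x. x \<in> A \<Longrightarrow> fsupp (f x)"
  shows "ev (tsumset f A) = (\<Sum>x\<in>A. ev (f x))"
  using assms
  by (induction A rule: finite_induct) (simp_all add: tsumset_empty tsumset_insert fsupp_tsumset)

text \<open>A finitely supported tensor is a finite linear combination of words, which reduces
  linear claims to \<open>tmono\<close>.\<close>

lemma fsupp_induct [consumes 1, case_names zero mono add scale]:
  assumes "fsupp t"
    and zero: "P tzero" and mono: "\<And>u. P (tmono u)"
    and add: "\<And>a b. fsupp a \<Longrightarrow> fsupp b \<Longrightarrow> P a \<Longrightarrow> P b \<Longrightarrow> P (tadd a b)"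
    and scale: "\<And>k a. fsupp a \<Longrightarrow> P a \<Longrightarrow> P (tscale k a)"
  shows "P t"
proof -
  have "P (tsumset (\<lambda>u. tscale (t u) (tmono u)) A)" if "finite A" for A
    using that
    by (induction A rule: finite_induct)
      (auto simp: tsumset_empty tsumset_insert zero intro!: add scale mono fsupp_tsumset)
  moreover have "tsumset (\<lambda>u. tscale (t u) (tmono u)) {u. t u \<noteq> 0} = t"
    using assms(1) by (auto simp: tsumset_def tscale_def tmono_def fun_eq_iff fsupp_def if_distrib
        sum.delta cong: if_cong)
  ultimately show ?thesis using assms(1) by (metis fsupp_def)
qed

lemma tmult_tmono_left:
  "tmult (tmono u) t = (\<lambda>w. if take (length u) w = u then t (drop (length u) w) else 0)"
proof
  fix w
  have "tmult (tmono u) t w = (\<Sum>i\<le>length w. if i = length u then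
      (if take (length u) w = u then t (drop (length u) w) else 0) else 0)"
    unfolding tmult_def tmono_def by (rule sum.cong) auto
  also have "\<dots> = (if take (length u) w = u then t (drop (length u) w) else 0)"
    by (auto simp: not_le)
  finally show "tmult (tmono u) t w = (if take (length u) w = u then t (drop (length u) w) else 0)" .
qed

lemma tmult_tmono: "tmult (tmono u) (tmono v) = tmono (u @ v)"
proof
  fix w
  have "take (length u) w = u \<and> drop (length u) w = v \<longleftrightarrow> w = u @ v"
    by (metis append_eq_conv_conj)
  then show "tmult (tmono u) (tmono v) w = tmono (u @ v) w"
    by (auto simp: tmult_tmono_left) (auto simp: tmono_def)
qed

lemma tmult_linear:
  "tmult tzero t = tzero" "tmult t tzero = tzero"
  "tmult (tadd a b) t = tadd (tmult a t) (tmult b t)"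
  "tmult t (tadd a b) = tadd (tmult t a) (tmult t b)"
  "tmult (tscale k a) t = tscale k (tmult a t)"
  "tmult t (tscale k a) = tscale k (tmult t a)"
  by (simp_all add: tmult_def tadd_def tscale_def tzero_def fun_eq_iff algebra_simps sum.distrib
      sum_distrib_left)

lemma tmult_Cons: "tmult (tmono (x # u)) t = tmult (tmono [x]) (tmult (tmono u) t)"
proof
  fix w
  show "tmult (tmono (x # u)) t w = tmult (tmono [x]) (tmult (tmono u) t) w"
    by (cases w) (auto simp: tmult_tmono_left)
qed

lemma tmult_fsupp_ev:
  assumes "fsupp a" "fsupp b"
  shows "fsupp (tmult a b) \<and> ev (tmult a b) = ev a * ev b"
  using assms(1)
proof (induction a rule: fsupp_induct)
  case (mono u)
  show ?case using assms(2)
    by (induction b rule: fsupp_induct)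
      (simp_all add: tmult_linear tmult_tmono distrib_left scal_left_commute)
qed (simp_all add: tmult_linear distrib_right mult.assoc)

lemma fsupp_tmult [simp]: "fsupp a \<Longrightarrow> fsupp b \<Longrightarrow> fsupp (tmult a b)"
  and ev_tmult [simp]: "fsupp a \<Longrightarrow> fsupp b \<Longrightarrow> ev (tmult a b) = ev a * ev b"
  using tmult_fsupp_ev by auto

lemma fsupp_tpow [simp]: "fsupp a \<Longrightarrow> fsupp (tpow a n)"
  and ev_tpow [simp]: "fsupp a \<Longrightarrow> ev (tpow a n) = ev a ^ n"
  by (induction n) simp_all

lemma fsupp_brk [simp]: "fsupp (brk x y)"
  by (cases "(x, y)" rule: brk.cases) simp_all

text \<open>This checks the superbracket relations on all sixteen pairs of letters; by it
  \<open>ev\<close> kills every generator of \<open>uideal\<close>.\<close>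

lemma ev_brk: "ev (brk x y) = rep x * rep y - scal (ksign x y) * rep y * rep x"
  by (cases x; cases y) (simp_all add: ksign_def scal_hom m2_eq_iff algebra_simps)

lemma fsupp_urel [simp]: "fsupp (urel x y)"
  by (simp add: urel_def)

lemma ev_urel [simp]: "ev (urel x y) = 0"
  by (simp add: urel_def ev_brk scal_hom algebra_simps)

lemma uideal_ev: "t \<in> uideal \<Longrightarrow> fsupp t \<and> ev t = 0"
  by (induction rule: uideal.induct) simp_all

section \<open>Faithfulness of the representation\<close>

lemma tens_simps: "tscale k (tadd a b) = tadd (tscale k a) (tscale k b)"
  "tscale k (tscale l a) = tscale (k * l) a" "tscale 1 a = a" "tscale 0 a = tzero"
  "tscale k tzero = tzero" "tadd a tzero = a" "tadd tzero a = a"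
  by (simp_all add: tscale_def tadd_def tzero_def algebra_simps)

lemma uideal_tscale: "t \<in> uideal \<Longrightarrow> tscale k t \<in> uideal"
  by (induction rule: uideal.induct) (auto simp: tens_simps intro: uideal.intros)

lemma uideal_tmult_left: "t \<in> uideal \<Longrightarrow> tmult (tmono [x]) t \<in> uideal"
  by (induction rule: uideal.induct)
    (auto simp: tmult_linear tmult_Cons[symmetric] intro: uideal.intros)

lemma ueq_refl [simp]: "ueq a a"
proof -
  have "tadd a (tscale (-1) a) = tzero" by (simp add: tadd_def tscale_def tzero_def)
  then show ?thesis by (simp add: ueq_def uideal.intros)
qed

lemma ueq_trans [trans]:
  assumes "ueq a b" "ueq b c"
  shows "ueq a c"
proof -
  have "tadd a (tscale (-1) c) = tadd (tadd a (tscale (-1) b)) (tadd b (tscale (-1) c))"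
    by (simp add: tadd_def tscale_def)
  then show ?thesis using assms by (simp add: ueq_def uideal.intros)
qed

lemma ueq_tadd:
  assumes "ueq a b" "ueq c d"
  shows "ueq (tadd a c) (tadd b d)"
proof -
  have "tadd (tadd a c) (tscale (-1) (tadd b d)) =
      tadd (tadd a (tscale (-1) b)) (tadd c (tscale (-1) d))"
    by (simp add: tadd_def tscale_def algebra_simps)
  then show ?thesis using assms by (simp add: ueq_def uideal.intros)
qed

lemma ueq_tscale:
  assumes "ueq a b"
  shows "ueq (tscale k a) (tscale k b)"
proof -
  have "tadd (tscale k a) (tscale (-1) (tscale k b)) = tscale k (tadd a (tscale (-1) b))"
    by (simp add: tadd_def tscale_def algebra_simps)
  then show ?thesis using assms by (simp add: ueq_def uideal_tscale)
qed

lemma ueq_tmult_left: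
  assumes "ueq a b"
  shows "ueq (tmult (tmono [x]) a) (tmult (tmono [x]) b)"
proof -
  have "tadd (tmult (tmono [x]) a) (tscale (-1) (tmult (tmono [x]) b)) =
      tmult (tmono [x]) (tadd a (tscale (-1) b))"
    by (simp add: tmult_linear)
  then show ?thesis using assms by (simp add: ueq_def uideal_tmult_left)
qed

text \<open>A relation of the ideal with empty left context: neighbouring letters may be exchanged
  at the price of a shorter word.\<close>

lemma ueq_swap:
  "ueq (tmono (x # y # v))
     (tadd (tscale (ksign x y) (tmono (y # x # v))) (tmult (brk x y) (tmono v)))"
proof -
  have [simp]: "tmult (tmono []) t = t" for t
    by (simp add: tmult_tmono_left)
  have "tscale 1 (tmult (tmono []) (tmult (urel x y) (tmono v))) \<in> uideal"
    by (rule uideal.intros)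
  also have "tscale 1 (tmult (tmono []) (tmult (urel x y) (tmono v))) =
      tadd (tmono (x # y # v)) (tscale (-1)
     (tadd (tscale (ksign x y) (tmono (y # x # v))) (tmult (brk x y) (tmono v))))"
    by (simp add: urel_def tmult_linear tmult_tmono tens_simps)
  finally show ?thesis by (simp add: ueq_def)
qed

lemma ueq_double_zero:
  assumes "ueq a (tscale (-1) a)"
  shows "ueq a tzero"
proof -
  \<comment> \<open>Twice the tensor lies in the ideal, and 2 is invertible.\<close>
  have "a = tscale (1/2) (tadd a (tscale (-1) (tscale (-1) a)))"
    by (simp add: tadd_def tscale_def)
  then have "a \<in> uideal" using assms uideal_tscale by (metis ueq_def)
  then show ?thesis by (simp add: ueq_def tens_simps)
qed

section \<open>PBW monomials span the enveloping algebra\<close>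

definition normal :: "nat \<Rightarrow> nat \<Rightarrow> gb list \<Rightarrow> gb list" where
  "normal i j Y = replicate i H @ replicate j G @ Y"

definition tails :: "gb list set" where "tails = {[], [Qp], [Qm], [Qm, Qp]}"

inductive_set nspan :: "tens set" where
  "tzero \<in> nspan"
| "Y \<in> tails \<Longrightarrow> tmono (normal i j Y) \<in> nspan"
| "a \<in> nspan \<Longrightarrow> b \<in> nspan \<Longrightarrow> tadd a b \<in> nspan"
| "a \<in> nspan \<Longrightarrow> tscale k a \<in> nspan"

text \<open>Tensors congruent to a combination of PBW monomials. Straightening shows that every
  finitely supported tensor is of this kind; linear independence is left to the
  representation.\<close>

definition nmod :: "tens set" where "nmod = {t. \<exists>s\<in>nspan. ueq t s}"

lemma nmod_ueq: "ueq a b \<Longrightarrow> b \<in> nmod \<Longrightarrow> a \<in> nmod"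
  using ueq_trans unfolding nmod_def by blast

lemma nmod_tzero [simp]: "tzero \<in> nmod"
  using nspan.intros(1) by (auto simp: nmod_def intro!: ueq_refl)

lemma nmod_tadd: "a \<in> nmod \<Longrightarrow> b \<in> nmod \<Longrightarrow> tadd a b \<in> nmod"
  unfolding nmod_def using ueq_tadd nspan.intros(3) by blast

lemma nmod_tscale: "a \<in> nmod \<Longrightarrow> tscale k a \<in> nmod"
  unfolding nmod_def using ueq_tscale nspan.intros(4) by blast

lemma nspan_nmod: "a \<in> nspan \<Longrightarrow> a \<in> nmod"
  unfolding nmod_def by (auto intro: ueq_refl)

lemma nmod_normal: "Y \<in> tails \<Longrightarrow> tmono (normal i j Y) \<in> nmod"
  by (simp add: nspan_nmod nspan.intros)

text \<open>Left multiplication by a letter is linear and respects the congruence, so only its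
  effect on PBW monomials has to be straightened.\<close>

lemma nmod_tmult_leftI:
  assumes t: "t \<in> nmod"
    and base: "\<And>i j Y. Y \<in> tails \<Longrightarrow> tmono (x # normal i j Y) \<in> nmod"
  shows "tmult (tmono [x]) t \<in> nmod"
proof -
  have "tmult (tmono [x]) s \<in> nmod" if "s \<in> nspan" for s
    using that
    by (induction rule: nspan.induct)
      (simp_all add: tmult_linear tmult_tmono base nmod_tadd nmod_tscale)
  moreover obtain s where "s \<in> nspan" "ueq t s" using t by (auto simp: nmod_def)
  ultimately show ?thesis using nmod_ueq ueq_tmult_left by blast
qed

lemma nmod_H: "t \<in> nmod \<Longrightarrow> tmult (tmono [H]) t \<in> nmod"
proof (rule nmod_tmult_leftI)
  fix i j Y assume "Y \<in> tails"
  then show "tmono (H # normal i j Y) \<in> nmod"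
    using nmod_normal[of Y "Suc i" j] by (simp add: normal_def)
qed

text \<open>\<open>H\<close> is central and even, so \<open>x\<close> moves through the block of
  \<open>H\<close> without a correction term.\<close>

lemma nmod_past_H:
  assumes "tmono (x # v) \<in> nmod"
  shows "tmono (x # replicate i H @ v) \<in> nmod"
proof (induction i)
  case (Suc i)
  have "ueq (tmono (x # H # replicate i H @ v)) (tmono (H # x # replicate i H @ v))"
    using ueq_swap[of x H "replicate i H @ v"]
    by (cases x) (simp_all add: ksign_def tens_simps tmult_linear)
  moreover have "tmono (H # x # replicate i H @ v) \<in> nmod"
    using nmod_H[OF Suc] by (simp add: tmult_tmono)
  ultimately show ?case using nmod_ueq by simp
qed (use assms in simp)

lemma nmod_G: "t \<in> nmod \<Longrightarrow> tmult (tmono [G]) t \<in> nmod"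
proof (rule nmod_tmult_leftI)
  fix i j Y assume "Y \<in> tails"
  then show "tmono (G # normal i j Y) \<in> nmod"
    using nmod_normal[of Y 0 "Suc j"] nmod_past_H[of G "replicate j G @ Y" i]
    by (simp add: normal_def)
qed

text \<open>An odd letter passes \<open>G\<close> at the cost of a multiple of itself, in a word
  with one \<open>G\<close> fewer; hence the induction on the number of \<open>G\<close>.\<close>

lemma nmod_odd_past_G:
  assumes x: "godd x" and base: "tmono (x # v) \<in> nmod"
  shows "tmono (x # replicate j G @ v) \<in> nmod"
proof (induction j)
  case (Suc j)
  let ?v = "replicate j G @ v"
  have "\<exists>k. ueq (tmono (x # G # ?v)) (tadd (tmono (G # x # ?v)) (tscale k (tmono (x # ?v))))"
  proof (cases "x = Qp")
    case True
    then show ?thesis using ueq_swap[of x G ?v]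
      by (intro exI[of _ "-1"]) (simp add: ksign_def tens_simps tmult_linear tmult_tmono)
  next
    case False
    then have "x = Qm" using x by (cases x) auto
    then show ?thesis using ueq_swap[of x G ?v]
      by (intro exI[of _ 1]) (simp add: ksign_def tens_simps tmult_linear tmult_tmono)
  qed
  moreover have "tmono (G # x # ?v) \<in> nmod"
    using nmod_G[OF Suc] by (simp add: tmult_tmono)
  ultimately show ?case using nmod_ueq nmod_tadd nmod_tscale Suc by fastforce
qed (use base in simp)

lemma nmod_tails:
  assumes "v \<in> tails" shows "tmono v \<in> nmod"
  using nmod_normal[OF assms, of 0 0] by (simp add: normal_def)

lemma ueq_square_zero:
  assumes "godd x" shows "ueq (tmono (x # x # v)) tzero"
proof (rule ueq_double_zero)
  show "ueq (tmono (x # x # v)) (tscale (-1) (tmono (x # x # v)))"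
    using ueq_swap[of x x v] assms by (cases x) (simp_all add: ksign_def tens_simps tmult_linear)
qed

lemma nmod_Qm: "t \<in> nmod \<Longrightarrow> tmult (tmono [Qm]) t \<in> nmod"
proof (rule nmod_tmult_leftI)
  fix i j Y assume "Y \<in> tails"
  \<comment> \<open>If the tail starts with \<open>Qm\<close>, the word vanishes in U because the
    square of an odd letter does; otherwise the result is again a tail.\<close>
  then have "tmono (Qm # Y) \<in> nmod"
    using nmod_ueq[OF ueq_square_zero[of Qm]]
    by (auto simp: tails_def intro: nmod_tails[unfolded tails_def])
  then show "tmono (Qm # normal i j Y) \<in> nmod"
    by (simp add: normal_def nmod_past_H nmod_odd_past_G)
qed

lemma nmod_Qp: "t \<in> nmod \<Longrightarrow> tmult (tmono [Qp]) t \<in> nmod"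
proof (rule nmod_tmult_leftI)
  fix i j Y assume Y: "Y \<in> tails"
  \<comment> \<open>Tails have \<open>Qm\<close> before \<open>Qp\<close>; restoring this order
    leaves an extra term with \<open>H\<close> in front.\<close>
  have swap: "tmono (Qp # Qm # v) \<in> nmod"
    if "tmono (Qp # v) \<in> nmod" "tmono v \<in> nmod" for v
  proof -
    have "ueq (tmono (Qp # Qm # v)) (tadd (tscale (-1) (tmono (Qm # Qp # v))) (tmono (H # v)))"
      using ueq_swap[of Qp Qm v] by (simp add: ksign_def tmult_tmono)
    moreover have "tmono (Qm # Qp # v) \<in> nmod" "tmono (H # v) \<in> nmod"
      using nmod_Qm[OF that(1)] nmod_H[OF that(2)] by (simp_all add: tmult_tmono)
    ultimately show ?thesis using nmod_ueq nmod_tadd nmod_tscale by blast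
  qed
  have tl: "tmono [] \<in> nmod" "tmono [Qp] \<in> nmod"
    by (simp_all add: nmod_tails tails_def)
  have sq: "tmono [Qp, Qp] \<in> nmod" using nmod_ueq[OF ueq_square_zero[of Qp]] by simp
  have "tmono (Qp # Y) \<in> nmod"
    using Y tl sq swap[OF tl(2,1)] swap[OF sq tl(2)] by (auto simp: tails_def)
  then show "tmono (Qp # normal i j Y) \<in> nmod"
    by (simp add: normal_def nmod_past_H nmod_odd_past_G)
qed

lemma tmono_nmod: "tmono u \<in> nmod"
proof (induction u)
  case Nil
  then show ?case by (simp add: nmod_tails tails_def)
next
  case (Cons x u)
  then have "tmult (tmono [x]) (tmono u) \<in> nmod"
    by (cases x) (simp_all add: nmod_H nmod_G nmod_Qp nmod_Qm)
  then show ?case by (simp add: tmult_tmono)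
qed

lemma fsupp_nmod: "fsupp t \<Longrightarrow> t \<in> nmod"
  by (induction rule: fsupp_induct) (simp_all add: tmono_nmod nmod_tadd nmod_tscale)

section \<open>Reading off the coordinates of a normal combination from its matrix\<close>

lemma normal_inject:
  assumes "Y \<in> tails" "Z \<in> tails"
  shows "normal i j Y = normal k l Z \<longleftrightarrow> i = k \<and> j = l \<and> Y = Z"
proof
  assume eq: "normal i j Y = normal k l Z"
  have rep: "count_list (replicate n x) y = (if x = y then n else 0)" for n and x y :: gb
    by (induction n) auto
  have "count_list (normal i j Y) H = count_list (normal k l Z) H"
    "count_list (normal i j Y) G = count_list (normal k l Z) G" using eq by simp_all
  then have "i = k" "j = l"
    using assms by (auto simp: normal_def tails_def rep)
  then show "i = k \<and> j = l \<and> Y = Z" using eq by (simp add: normal_def)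
qed simp

text \<open>The substitution of b + 1 for b appears because \<open>G\<close> acts by b + 1 on the
  second basis vector.\<close>

definition shift :: "complex poly poly \<Rightarrow> complex poly poly" where
  "shift f = pcompose f (vb + 1)"

lemma shift_linear: "shift (f + g) = shift f + shift g" "shift (smult k f) = smult k (shift f)"
  "shift 0 = 0"
  by (simp_all add: shift_def pcompose_add pcompose_smult)

lemma shift_eq_0_iff: "shift f = 0 \<longleftrightarrow> f = 0"
proof -
  have "vb + 1 = [:1, 1:]" by (simp add: vb_def one_pCons)
  then have "degree (vb + 1) = 1" by simp
  then show ?thesis unfolding shift_def using pcompose_eq_0[of f "vb + 1"] by auto
qed

lemma repw_normal:
  "repw (normal i j Y) = sc (va ^ i) * M2 (vb ^ j) 0 0 ((vb + 1) ^ j) * repw Y"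
proof -
  have H: "repw (replicate i H) = sc (va ^ i)"
    by (induction i) (simp_all add: m2_eq_iff)
  have G: "repw (replicate j G) = M2 (vb ^ j) 0 0 ((vb + 1) ^ j)"
    by (induction j) (simp_all add: m2_eq_iff)
  show ?thesis by (simp add: normal_def H G mult.assoc)
qed

lemma monom_eq_va_vb: "monom (monom 1 i) j = va ^ i * vb ^ j"
proof -
  have "va ^ i = [:monom 1 i:]"
    by (induction i) (simp_all add: va_def pCons_one monom_Suc)
  moreover have "vb ^ j = monom 1 j"
    by (induction j) (simp_all add: vb_def monom_Suc pCons_one)
  ultimately show ?thesis by (simp add: smult_monom)
qed

lemma pcompose_power: "pcompose (p ^ n) q = pcompose p q ^ n"
  by (induction n) (simp_all add: pcompose_mult pcompose_1)

lemma shift_va_vb: "shift (va ^ i * vb ^ j) = va ^ i * (vb + 1) ^ j"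
proof -
  have "pcompose va (vb + 1) = va" "pcompose vb (vb + 1) = vb + 1"
    by (simp_all add: va_def vb_def pcompose_pCons)
  then show ?thesis by (simp add: shift_def pcompose_mult pcompose_power)
qed

text \<open>For a tail \<open>Y\<close>, \<open>f Y\<close> is the generating polynomial in a and b
  of the coefficients on H^i G^j Y. The four tails reach the matrix entries in a triangular way, so
  the matrix determines all four polynomials.\<close>

lemma nspan_coeffs:
  assumes "s \<in> nspan"
  shows "\<exists>f. ev s = M2 (f [] + va * f [Qm, Qp]) (va * f [Qm]) (shift (f [Qp])) (shift (f [])) \<and>
    (\<forall>Y\<in>tails. \<forall>i j. s (normal i j Y) = coeff (coeff (f Y) j) i) \<and>
    (\<forall>u. (\<forall>Y\<in>tails. \<forall>i j. u \<noteq> normal i j Y) \<longrightarrow> s u = 0) \<and> fsupp s"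
  using assms
proof (induction rule: nspan.induct)
  case 1
  show ?case
    by (rule exI[of _ "\<lambda>_. 0"]) (simp add: shift_linear m2_eq_iff, simp add: tzero_def)
next
  case (2 Y i j)
  let ?f = "\<lambda>Z. if Z = Y then monom (monom 1 i) j else 0"
  have "ev (tmono (normal i j Y)) =
      M2 (?f [] + va * ?f [Qm, Qp]) (va * ?f [Qm]) (shift (?f [Qp])) (shift (?f []))"
    using 2 by (auto simp: tails_def repw_normal m2_eq_iff shift_va_vb shift_linear
        monom_eq_va_vb mult_ac)
  moreover have "\<forall>Z\<in>tails. \<forall>k l. tmono (normal i j Y) (normal k l Z) = coeff (coeff (?f Z) l) k"
    using 2 by (auto simp: tmono_def normal_inject)
  moreover have "\<forall>u. (\<forall>Y\<in>tails. \<forall>i j. u \<noteq> normal i j Y) \<longrightarrow> tmono (normal i j Y) u = 0"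
    using 2 by (auto simp: tmono_def)
  ultimately show ?case by (intro exI[of _ ?f]) simp
next
  case (3 a b)
  then obtain f g where
    "ev a = M2 (f [] + va * f [Qm, Qp]) (va * f [Qm]) (shift (f [Qp])) (shift (f []))"
    "ev b = M2 (g [] + va * g [Qm, Qp]) (va * g [Qm]) (shift (g [Qp])) (shift (g []))"
    "\<forall>Y\<in>tails. \<forall>i j. a (normal i j Y) = coeff (coeff (f Y) j) i"
    "\<forall>Y\<in>tails. \<forall>i j. b (normal i j Y) = coeff (coeff (g Y) j) i"
    "\<forall>u. (\<forall>Y\<in>tails. \<forall>i j. u \<noteq> normal i j Y) \<longrightarrow> a u = 0 \<and> b u = 0" "fsupp a" "fsupp b"
    by blast
  then show ?case
    by (intro exI[of _ "\<lambda>Y. f Y + g Y"])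
      (simp add: m2_eq_iff shift_linear algebra_simps, simp add: tadd_def)
next
  case (4 a k)
  then obtain f where
    "ev a = M2 (f [] + va * f [Qm, Qp]) (va * f [Qm]) (shift (f [Qp])) (shift (f []))"
    "\<forall>Y\<in>tails. \<forall>i j. a (normal i j Y) = coeff (coeff (f Y) j) i"
    "\<forall>u. (\<forall>Y\<in>tails. \<forall>i j. u \<noteq> normal i j Y) \<longrightarrow> a u = 0" "fsupp a"
    by blast
  then show ?case
    by (intro exI[of _ "\<lambda>Y. smult [:k:] (f Y)"])
      (simp add: m2_eq_iff scal_def shift_linear algebra_simps smult_add_right, simp add: tscale_def)
qed

text \<open>The lower right entry gives \<open>f []\<close>, then the upper left one
  \<open>f [Qm, Qp]\<close>; the off-diagonal entries give the rest, as a is not a zero divisor and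
  \<open>shift\<close> is injective.\<close>

lemma nspan_faithful:
  assumes "s \<in> nspan" "ev s = 0"
  shows "s = tzero"
proof
  fix u
  obtain f where
    f: "ev s = M2 (f [] + va * f [Qm, Qp]) (va * f [Qm]) (shift (f [Qp])) (shift (f []))"
      "\<forall>Y\<in>tails. \<forall>i j. s (normal i j Y) = coeff (coeff (f Y) j) i"
      "\<forall>u. (\<forall>Y\<in>tails. \<forall>i j. u \<noteq> normal i j Y) \<longrightarrow> s u = 0"
    using nspan_coeffs[OF assms(1)] by blast
  have "va \<noteq> 0" by (simp add: va_def)
  then have "\<forall>Y\<in>tails. f Y = 0"
    using f(1) assms(2) by (auto simp: m2_eq_iff shift_eq_0_iff tails_def)
  then show "s u = tzero u"
    using f(2,3) by (cases "\<exists>Y\<in>tails. \<exists>i j. u = normal i j Y") (auto simp: tzero_def)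
qed

lemma ev_cong: "ueq a b \<Longrightarrow> fsupp a \<Longrightarrow> fsupp b \<Longrightarrow> ev a = ev b"
  unfolding ueq_def by (drule uideal_ev) (simp add: scal_hom)

text \<open>The difference is straightened to a combination of PBW monomials, and equal values force
  that combination to vanish. Hence equations in U can be checked on matrices.\<close>

theorem ueq_iff_ev:
  assumes "fsupp a" "fsupp b"
  shows "ueq a b \<longleftrightarrow> ev a = ev b"
proof
  assume eq: "ev a = ev b"
  let ?t = "tadd a (tscale (-1) b)"
  have t: "fsupp ?t" using assms by simp
  then obtain s where s: "s \<in> nspan" "ueq ?t s" using fsupp_nmod by (auto simp: nmod_def)
  have "fsupp s" using nspan_coeffs[OF s(1)] by blast
  then have "ev s = ev ?t" using ev_cong[OF s(2) t] by simp
  then have "ev s = 0" using eq assms by (simp add: scal_hom)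
  then have "ueq ?t tzero" using nspan_faithful s by metis
  then show "ueq a b" by (simp add: ueq_def tens_simps)
qed (use ev_cong assms in blast)

section \<open>Centrality of the weight of a chord diagram\<close>

definition pair_factor :: "nat \<times> gb \<Rightarrow> nat \<times> gb \<Rightarrow> complex" where
  "pair_factor p q = (if fst p = fst q then Cc (snd p) (snd q)
     else if fst q < fst p then ksign (snd p) (snd q) else 1)"

text \<open>Equal labels contribute the contraction of a chord, inverted labels a Koszul sign. One
  product over pairs holds both, so that chords can be removed one at a time.\<close>

fun coef :: "(nat \<times> gb) list \<Rightarrow> complex" where
  "coef [] = 1"
| "coef (p # z) = prod_list (map (pair_factor p) z) * coef z"

definition less_pairs :: "nat \<Rightarrow> (nat \<times> nat) set" where
  "less_pairs n = {(a, b). a < b \<and> b < n}"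

lemma finite_less_pairs [simp]: "finite (less_pairs n)"
  by (rule finite_subset[of _ "{..<n} \<times> {..<n}"]) (auto simp: less_pairs_def)

lemma less_pairs_Suc:
  "less_pairs (Suc n) = Pair 0 ` Suc ` {..<n} \<union> map_prod Suc Suc ` less_pairs n"
proof -
  have "(a, b) \<in> less_pairs (Suc n) \<longleftrightarrow>
      (a, b) \<in> Pair 0 ` Suc ` {..<n} \<union> map_prod Suc Suc ` less_pairs n" for a b
    by (cases a; cases b) (auto simp: less_pairs_def image_iff)
  then show ?thesis by auto
qed

lemma coef_eq_prod: "coef z = (\<Prod>(a, b)\<in>less_pairs (length z). pair_factor (z ! a) (z ! b))"
proof (induction z)
  case Nil
  then show ?case by (simp add: less_pairs_def)
next
  case (Cons p z)
  let ?f = "\<lambda>(a, b). pair_factor ((p # z) ! a) ((p # z) ! b)"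
  have "prod ?f (less_pairs (length (p # z))) =
      prod ?f (Pair 0 ` Suc ` {..<length z}) * prod ?f (map_prod Suc Suc ` less_pairs (length z))"
    unfolding length_Cons less_pairs_Suc
    by (rule prod.union_disjoint) auto
  also have "prod ?f (Pair 0 ` Suc ` {..<length z}) = (\<Prod>i<length z. pair_factor p (z ! i))"
    by (simp add: prod.reindex inj_on_def image_image)
  also have "\<dots> = prod_list (map (pair_factor p) z)"
    by (simp add: prod.list_conv_set_nth atLeast0LessThan)
  also have "prod ?f (map_prod Suc Suc ` less_pairs (length z)) = coef z"
    unfolding Cons by (subst prod.reindex) (auto simp: inj_on_def intro!: prod.cong)
  finally show ?case by simp
qed

text \<open>Contractions concern pairs with equal labels and signs concern pairs with inverted
  labels, so the two products merge.\<close>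

lemma coef_zip:
  assumes "length l = length w"
  shows "(\<Prod>(a, b)\<in>chord_pairs w. Cc (l ! a) (l ! b)) * koszul w l = coef (zip w l)"
proof -
  let ?P = "less_pairs (length w)"
  let ?S = "{(a, b). a < b \<and> b < length w \<and> godd (l ! a) \<and> godd (l ! b) \<and> kless w b a}"
  \<comment> \<open>With equal labels the later position has \<open>kflag\<close> 1 and so never
    precedes the earlier one in the canonical order.\<close>
  have kless: "kless w b a \<longleftrightarrow> w ! b < w ! a" if "a < b" for a b
    using that by (auto simp: kless_def kflag_def)
  have "(\<Prod>(a, b)\<in>chord_pairs w. Cc (l ! a) (l ! b)) =
      (\<Prod>(a, b)\<in>?P. if w ! a = w ! b then Cc (l ! a) (l ! b) else 1)"
    by (rule prod.mono_neutral_cong_left[OF finite_less_pairs])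
      (auto simp: chord_pairs_def less_pairs_def split: if_splits)
  moreover have "koszul w l = (\<Prod>(a, b)\<in>?S. - 1)"
    by (simp add: koszul_def case_prod_unfold)
  moreover have "(\<Prod>(a, b)\<in>?S. - 1) =
      (\<Prod>(a, b)\<in>?P. if w ! b < w ! a then ksign (l ! a) (l ! b) else 1)"
    by (rule prod.mono_neutral_cong_left[OF finite_less_pairs])
      (auto simp: less_pairs_def kless ksign_def split: if_splits)
  ultimately have "(\<Prod>(a, b)\<in>chord_pairs w. Cc (l ! a) (l ! b)) * koszul w l =
      (\<Prod>x\<in>?P. (case x of (a, b) \<Rightarrow> if w ! a = w ! b then Cc (l ! a) (l ! b) else 1) *
        (case x of (a, b) \<Rightarrow> if w ! b < w ! a then ksign (l ! a) (l ! b) else 1))"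
    by (simp add: prod.distrib)
  also have "\<dots> = coef (zip w l)"
    unfolding coef_eq_prod
    by (rule prod.cong) (use assms in \<open>auto simp: less_pairs_def pair_factor_def\<close>)
  finally show ?thesis .
qed

section \<open>Sums over words of basis letters\<close>

definition words :: "nat \<Rightarrow> gb list set" where "words n = {l. length l = n}"

lemma UNIV_gb: "(UNIV :: gb set) = {H, G, Qp, Qm}"
proof (rule UNIV_eq_I)
  show "x \<in> {H, G, Qp, Qm}" for x by (cases x) simp_all
qed

lemma sum_gb: "sum f (UNIV :: gb set) = f H + f G + f Qp + (f Qm :: 'a :: comm_monoid_add)"
  by (simp add: UNIV_gb add.assoc)

lemma words_eq_n_lists: "set (List.n_lists n [H, G, Qp, Qm]) = words n"
  by (auto simp: words_def set_n_lists UNIV_gb[symmetric])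

lemma finite_words [simp]: "finite (words n)"
  unfolding words_eq_n_lists[symmetric] by simp

lemma length_words: "l \<in> words n \<Longrightarrow> length l = n"
  by (simp add: words_def)

lemma sum_words_0: "sum f (words 0) = f []"
  by (simp add: words_def)

lemma sum_words_append:
  "sum f (words (m + n)) = (\<Sum>u\<in>words m. \<Sum>v\<in>words n. f (u @ v))"
proof -
  have "(\<Sum>u\<in>words m. \<Sum>v\<in>words n. f (u @ v)) = (\<Sum>(u, v)\<in>words m \<times> words n. f (u @ v))"
    by (rule sum.cartesian_product)
  also have "\<dots> = sum f (words (m + n))"
    by (rule sum.reindex_bij_witness[of _ "\<lambda>l. (take m l, drop m l)" "\<lambda>(u, v). u @ v"])
      (auto simp: words_def)
  finally show ?thesis by (rule sym)
qed

lemma sum_words_Suc: "sum f (words (Suc n)) = (\<Sum>g\<in>UNIV. \<Sum>l\<in>words n. f (g # l))"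
proof -
  have "(\<Sum>g\<in>UNIV. \<Sum>l\<in>words n. f (g # l)) = (\<Sum>(g, l)\<in>UNIV \<times> words n. f (g # l))"
    by (rule sum.cartesian_product)
  also have "\<dots> = sum f (words (Suc n))"
    by (rule sum.reindex_bij_witness[of _ "\<lambda>l. (hd l, tl l)" "\<lambda>(g, l). g # l"])
      (auto simp: words_def length_Suc_conv)
  finally show ?thesis by (rule sym)
qed

lemma sum_swap_chord:
  "(\<Sum>g\<in>X. \<Sum>v\<in>V. \<Sum>h\<in>Y. \<Sum>t\<in>T. f g v h t) =
   (\<Sum>v\<in>V. \<Sum>t\<in>T. \<Sum>g\<in>X. \<Sum>h\<in>Y. f g v h t :: 'a :: comm_monoid_add)"
proof -
  have "(\<Sum>g\<in>X. \<Sum>v\<in>V. \<Sum>h\<in>Y. \<Sum>t\<in>T. f g v h t) =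
      (\<Sum>v\<in>V. \<Sum>g\<in>X. \<Sum>h\<in>Y. \<Sum>t\<in>T. f g v h t)"
    by (rule sum.swap)
  also have "\<dots> = (\<Sum>v\<in>V. \<Sum>g\<in>X. \<Sum>t\<in>T. \<Sum>h\<in>Y. f g v h t)"
    by (rule sum.cong[OF refl], rule sum.cong[OF refl], rule sum.swap)
  also have "\<dots> = (\<Sum>v\<in>V. \<Sum>t\<in>T. \<Sum>g\<in>X. \<Sum>h\<in>Y. f g v h t)"
    by (rule sum.cong[OF refl], rule sum.swap)
  finally show ?thesis .
qed

lemma sum_words_chord:
  "sum f (words (length (A @ x # B @ x # D))) =
     (\<Sum>u\<in>words (length A). \<Sum>v\<in>words (length B). \<Sum>t\<in>words (length D).
        \<Sum>g\<in>UNIV. \<Sum>h\<in>UNIV. f (u @ g # v @ h # t))"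
  unfolding length_append length_Cons sum_words_append sum_words_Suc
  by (rule sum.cong[OF refl], rule sum_swap_chord)

definition ev_chords :: "nat list \<Rightarrow> complex poly poly m2" where
  "ev_chords w = (\<Sum>l\<in>words (length w). scal (coef (zip w l)) * repw l)"

lemma fsupp_Wt [simp]: "fsupp (Wt w)"
  unfolding Wt_def by (rule fsupp_tsumset) simp_all

lemma ev_Wt: "ev (Wt w) = ev_chords w"
  unfolding Wt_def ev_chords_def words_eq_n_lists
  by (subst ev_tsumset) (simp_all add: coef_zip length_words)

section \<open>Chord words and deletion of a chord\<close>

lemma chord_split:
  assumes "chord_word w" "x \<in> set w"
  obtains A B D where "w = A @ x # B @ x # D" "x \<notin> set A" "x \<notin> set B" "x \<notin> set D"
proof -
  obtain A R where A: "w = A @ x # R" "x \<notin> set A" using split_list_first[OF assms(2)] by blast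
  have w: "count_list w x = 2" using assms by (simp add: chord_word_def)
  then have "count_list R x = 1" using A by simp
  then have "x \<in> set R" using count_notin[of x R] by (cases "x \<in> set R") simp_all
  then obtain B D where B: "R = B @ x # D" "x \<notin> set B" using split_list_first[of x R] by blast
  have "count_list D x = 0" using w A B by simp
  then have "x \<notin> set D" by (simp add: count_list_0_iff)
  then show ?thesis using that A B by simp
qed

lemma filter_neq_split:
  assumes "x \<notin> set A" "x \<notin> set B" "x \<notin> set D"
  shows "filter (\<lambda>y. y \<noteq> x) (A @ x # B @ x # D) = A @ B @ D"
proof -
  have "filter (\<lambda>y. y \<noteq> x) C = C" if "x \<notin> set C" for C
    using that by (auto simp: filter_id_conv)
  then show ?thesis using assms by simp
qed

lemma count_list_filter_neq: "count_list (filter (\<lambda>y. y \<noteq> x) w) z = (if z = x then 0 else count_list w z)"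
  by (induction w) auto

lemma chord_word_filter: "chord_word w \<Longrightarrow> chord_word (filter (\<lambda>y. y \<noteq> x) w)"
  by (simp add: chord_word_def count_list_filter_neq)

text \<open>The chord removed is the one through the first letter, so nothing precedes its first
  end.\<close>

lemma chord_word_induct [consumes 1, case_names Nil chord]:
  assumes "chord_word w" and "P []"
    and "\<And>x B D. x \<notin> set B \<Longrightarrow> x \<notin> set D \<Longrightarrow> P (B @ D) \<Longrightarrow> P (x # B @ x # D)"
  shows "P w"
  using assms(1)
proof (induction "length w" arbitrary: w rule: less_induct)
  case less
  show ?case
  proof (cases w)
    case Nil
    then show ?thesis using assms(2) by simp
  next
    case (Cons x w')
    then obtain A B D where w: "w = A @ x # B @ x # D" "x \<notin> set A" "x \<notin> set B" "x \<notin> set D"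
      using chord_split[of w x] less.prems by auto
    then have "A = []" using Cons by (cases A) auto
    moreover have "P (A @ B @ D)"
      using less chord_word_filter[OF less.prems, of x] filter_neq_split[OF w(2-4)] w(1) by simp
    ultimately show ?thesis using w assms(3) by simp
  qed
qed

section \<open>Signs and coefficients under removal of a chord\<close>

definition sgnprod :: "(gb \<Rightarrow> complex) \<Rightarrow> gb list \<Rightarrow> complex" where
  "sgnprod \<epsilon> u = prod_list (map \<epsilon> u)"

lemma sgnprod_simps [simp]: "sgnprod \<epsilon> [] = 1" "sgnprod \<epsilon> (x # u) = \<epsilon> x * sgnprod \<epsilon> u"
  "sgnprod \<epsilon> (u @ v) = sgnprod \<epsilon> u * sgnprod \<epsilon> v"
  by (simp_all add: sgnprod_def)

text \<open>Every sign for carrying a letter across a word reduces to that of one odd letter, so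
  later identities need only be checked for its two values.\<close>

lemma sgnprod_ksign:
  "sgnprod (ksign g) u = (if godd g then sgnprod (ksign Qp) u else 1)"
proof (cases "godd g")
  case True
  then have "ksign g = ksign Qp" by (simp add: ksign_def fun_eq_iff)
  then show ?thesis using True by simp
next
  case False
  then have "ksign g y = 1" for y by (simp add: ksign_def)
  then have "sgnprod (ksign g) u = 1" by (induction u) simp_all
  then show ?thesis using False by simp
qed

lemma sgnprod_ksign_cases: "sgnprod (ksign Qp) u = 1 \<or> sgnprod (ksign Qp) u = -1"
proof (induction u)
  case (Cons g u)
  have "ksign Qp g = 1 \<or> ksign Qp g = -1" by (simp add: ksign_def)
  then show ?case using Cons by auto
qed simp

lemma coef_append:
  "coef (z @ z') = coef z * coef z' * prod_list (map (\<lambda>p. prod_list (map (pair_factor p) z')) z)"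
  by (induction z) simp_all

lemma prod_list_map_mult:
  "prod_list (map (\<lambda>x. f x * g x) l) = prod_list (map f l) * (prod_list (map g l) :: 'a :: comm_monoid_mult)"
  by (induction l) (simp_all add: mult_ac)

lemma Cc_parity: "Cc g h \<noteq> 0 \<Longrightarrow> godd g = godd h"
  by (cases "(g, h)" rule: Cc.cases) auto

text \<open>Moving both ends of a chord to the front costs the sign of the letters between them;
  a letter outside is passed twice.\<close>

lemma coef_chord:
  assumes "x \<notin> fst ` set z1" "x \<notin> fst ` set z2" "x \<notin> fst ` set z3"
  shows "coef (z1 @ (x, g) # z2 @ (x, h) # z3) =
    Cc g h * sgnprod (ksign g) (map snd z2) * coef (z1 @ z2 @ z3)"
proof (cases "Cc g h = 0")
  case True
  then show ?thesis by (simp add: coef_append pair_factor_def)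
next
  case False
  let ?p = "(x, g)" and ?q = "(x, h)"
  have gh: "godd g = godd h" using Cc_parity[OF False] .
  have 1: "pair_factor r ?p * pair_factor r ?q = 1" if "r \<in> set z1" for r
    using that assms gh by (cases r) (auto simp: pair_factor_def ksign_def image_iff)
  have 2: "pair_factor ?p r * pair_factor r ?q = ksign g (snd r)" if "r \<in> set z2" for r
    using that assms gh by (cases r) (auto simp: pair_factor_def ksign_def image_iff)
  have 3: "pair_factor ?p r * pair_factor ?q r = 1" if "r \<in> set z3" for r
    using that assms gh by (cases r) (auto simp: pair_factor_def ksign_def image_iff)
  have one: "prod_list (map f l) = 1" if "\<And>r. r \<in> set l \<Longrightarrow> f r = 1" for f :: "nat \<times> gb \<Rightarrow> complex" and l
    using that by (induction l) auto
  have "prod_list (map (\<lambda>r. pair_factor r ?p * pair_factor r ?q) z1) = 1"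
    "prod_list (map (\<lambda>r. pair_factor ?p r * pair_factor ?q r) z3) = 1"
    by (rule one, erule 1, rule one, erule 3)
  moreover have "prod_list (map (\<lambda>r. pair_factor ?p r * pair_factor r ?q) z2) =
      sgnprod (ksign g) (map snd z2)"
    unfolding sgnprod_def map_map by (rule arg_cong[where f = prod_list]) (auto simp: 2)
  moreover have "pair_factor ?p ?q = Cc g h" by (simp add: pair_factor_def)
  moreover have "coef (z1 @ ?p # z2 @ ?q # z3) = pair_factor ?p ?q *
      prod_list (map (\<lambda>r. pair_factor r ?p * pair_factor r ?q) z1) *
      prod_list (map (\<lambda>r. pair_factor ?p r * pair_factor r ?q) z2) *
      prod_list (map (\<lambda>r. pair_factor ?p r * pair_factor ?q r) z3) * coef (z1 @ z2 @ z3)"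
    by (simp add: coef_append prod_list_map_mult mult_ac)
  ultimately show ?thesis by simp
qed

lemma coef_zip_chord:
  assumes "x \<notin> set A" "x \<notin> set B" "x \<notin> set D"
    and "length u = length A" "length v = length B" "length t = length D"
  shows "coef (zip (A @ x # B @ x # D) (u @ g # v @ h # t)) =
    Cc g h * sgnprod (ksign g) v * coef (zip (A @ B @ D) (u @ v @ t))"
proof -
  have "x \<notin> fst ` set (zip X y)" if "x \<notin> set X" for X and y :: "gb list"
    using that by (auto dest: set_zip_leftD)
  then show ?thesis using assms by (simp add: coef_chord)
qed

text \<open>The two letters on a chord have equal parity, so the signs cancel in pairs. Each nonzero
  contraction contains exactly one \<open>H\<close> or \<open>Qm\<close> and at most one
  \<open>G\<close>; this count later bounds the degree in b by the power of a.\<close>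

lemma coef_nonzero:
  assumes "chord_word w" "length l = length w" "coef (zip w l) \<noteq> 0"
  shows "sgnprod (ksign y) l = 1 \<and> count_list l G \<le> count_list l H + count_list l Qm"
  using assms
proof (induction w arbitrary: l rule: chord_word_induct)
  case Nil
  then show ?case by simp
next
  case (chord x B D)
  obtain g l' where l: "l = g # l'" using chord.prems by (cases l) auto
  define v where "v = take (length B) l'"
  obtain h t where t: "drop (length B) l' = h # t"
    using chord.prems l by (cases "drop (length B) l'") auto
  have l_eq: "l = g # v @ h # t" using l t v_def by (metis append_take_drop_id)
  have "length l' = length B + Suc (length D)" using chord.prems(1) l by simp
  moreover from this have "length (drop (length B) l') = Suc (length D)" by simp
  ultimately have len: "length v = length B" "length t = length D"
    unfolding t by (simp_all add: v_def)
  have "coef (zip (x # B @ x # D) l) =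
      Cc g h * sgnprod (ksign g) v * coef (zip (B @ D) (v @ t))"
    using coef_zip_chord[of x "[]" B D "[]" v t g h] chord.hyps len by (simp add: l_eq)
  then have nz: "Cc g h \<noteq> 0" "coef (zip (B @ D) (v @ t)) \<noteq> 0" using chord.prems by auto
  have IH: "sgnprod (ksign y) (v @ t) = 1 \<and>
      count_list (v @ t) G \<le> count_list (v @ t) H + count_list (v @ t) Qm"
    by (rule chord.IH) (use len nz in auto)
  have "ksign y g * ksign y h = 1" using Cc_parity[OF nz(1)] by (simp add: ksign_def)
  then have "sgnprod (ksign y) l = 1" using IH by (simp add: l_eq algebra_simps)
  moreover have "count_list l G \<le> count_list l H + count_list l Qm"
    using IH nz(1) by (cases "(g, h)" rule: Cc.cases) (auto simp: l_eq)
  ultimately show ?case by simp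
qed

section \<open>Twisted derivations and centrality\<close>

lemma scal_collect: "scal r * scal s = scal (r * s)" "scal r * (scal s * m) = scal (r * s) * m"
  by (simp_all add: scal_hom mult.assoc)

lemma rep_scal: "rep g * (scal r * m) = scal r * (rep g * m)"
  "repw u * (scal r * m) = scal r * (repw u * m)"
  by (simp_all add: scal_left_commute)

text \<open>The part of a twisted derivation that acts on the letters labelled \<open>x\<close>.\<close>

fun der :: "(gb \<Rightarrow> complex poly poly m2) \<Rightarrow> (gb \<Rightarrow> complex) \<Rightarrow> nat \<Rightarrow> (nat \<times> gb) list
    \<Rightarrow> complex poly poly m2" where
  "der \<delta> \<epsilon> x [] = 0"
| "der \<delta> \<epsilon> x ((c, g) # z) =
     (if c = x then \<delta> g * repw (map snd z) else 0) + scal (\<epsilon> g) * rep g * der \<delta> \<epsilon> x z"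

lemma der_eq_0: "x \<notin> fst ` set z \<Longrightarrow> der \<delta> \<epsilon> x z = 0"
  by (induction z) auto

lemma der_append:
  "x \<notin> fst ` set z \<Longrightarrow>
    der \<delta> \<epsilon> x (z @ z') = scal (sgnprod \<epsilon> (map snd z)) * repw (map snd z) * der \<delta> \<epsilon> x z'"
proof (induction z)
  case Nil
  then show ?case by (simp add: scal_hom)
next
  case (Cons p z)
  then show ?case
    by (cases p) (auto simp: scal_collect rep_scal mult.assoc)
qed

lemma der_chord:
  assumes "x \<notin> fst ` set z1" "x \<notin> fst ` set z2" "x \<notin> fst ` set z3"
  shows "der \<delta> \<epsilon> x (z1 @ (x, g) # z2 @ (x, h) # z3) =
    scal (sgnprod \<epsilon> (map snd z1)) * (repw (map snd z1) *
      ((\<delta> g * repw (map snd z2) * rep h +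
        scal (\<epsilon> g * sgnprod \<epsilon> (map snd z2)) * (rep g * repw (map snd z2) * \<delta> h)) *
       repw (map snd z3)))"
  using assms
  by (simp add: der_append der_eq_0 scal_collect rep_scal mult.assoc distrib_left distrib_right)

text \<open>Fixing all letters off the chord isolates a double sum over its two ends. Invariance and
  differentiation thereby become identities about a single chord.\<close>

lemma sum_der:
  assumes w: "w = A @ x # B @ x # D" "x \<notin> set A" "x \<notin> set B" "x \<notin> set D"
  shows "(\<Sum>l\<in>words (length w). scal (coef (zip w l)) * der \<delta> \<epsilon> x (zip w l)) =
    (\<Sum>u\<in>words (length A). \<Sum>v\<in>words (length B). \<Sum>t\<in>words (length D).
      scal (coef (zip (A @ B @ D) (u @ v @ t)) * sgnprod \<epsilon> u) * (repw u *
        ((\<Sum>g\<in>UNIV. \<Sum>h\<in>UNIV. scal (Cc g h * sgnprod (ksign g) v) *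
           (\<delta> g * repw v * rep h + scal (\<epsilon> g * sgnprod \<epsilon> v) * (rep g * repw v * \<delta> h))) * repw t)))"
proof -
  have notin: "x \<notin> fst ` set (zip X y)" if "x \<notin> set X" for X and y :: "gb list"
    using that by (auto dest: set_zip_leftD)
  have "scal (coef (zip w (u @ g # v @ h # t))) * der \<delta> \<epsilon> x (zip w (u @ g # v @ h # t)) =
      scal (coef (zip (A @ B @ D) (u @ v @ t)) * sgnprod \<epsilon> u) * (repw u *
        (scal (Cc g h * sgnprod (ksign g) v) *
           (\<delta> g * repw v * rep h + scal (\<epsilon> g * sgnprod \<epsilon> v) * (rep g * repw v * \<delta> h)) * repw t))"
    if "u \<in> words (length A)" "v \<in> words (length B)" "t \<in> words (length D)" for u v t g h
  proof -
    note len = that[THEN length_words]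
    have "zip w (u @ g # v @ h # t) = zip A u @ (x, g) # zip B v @ (x, h) # zip D t"
      using len by (simp add: w)
    then have der: "der \<delta> \<epsilon> x (zip w (u @ g # v @ h # t)) = scal (sgnprod \<epsilon> u) * (repw u *
      ((\<delta> g * repw v * rep h + scal (\<epsilon> g * sgnprod \<epsilon> v) * (rep g * repw v * \<delta> h)) * repw t))"
      using len by (simp add: der_chord notin w(2-4))
    have coef: "coef (zip w (u @ g # v @ h # t)) =
        Cc g h * sgnprod (ksign g) v * coef (zip (A @ B @ D) (u @ v @ t))"
      unfolding w(1) by (rule coef_zip_chord) (use w len in auto)
    show ?thesis
      unfolding der coef
      by (simp add: scal_collect rep_scal mult.assoc mult.commute mult.left_commute)
  qed
  then have "(\<Sum>l\<in>words (length w). scal (coef (zip w l)) * der \<delta> \<epsilon> x (zip w l)) =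
    (\<Sum>u\<in>words (length A). \<Sum>v\<in>words (length B). \<Sum>t\<in>words (length D). \<Sum>g\<in>UNIV. \<Sum>h\<in>UNIV.
      scal (coef (zip (A @ B @ D) (u @ v @ t)) * sgnprod \<epsilon> u) * (repw u *
        (scal (Cc g h * sgnprod (ksign g) v) *
           (\<delta> g * repw v * rep h + scal (\<epsilon> g * sgnprod \<epsilon> v) * (rep g * repw v * \<delta> h)) * repw t)))"
    unfolding w(1) sum_words_chord by (intro sum.cong refl)
  then show ?thesis by (simp add: sum_distrib_left sum_distrib_right)
qed

text \<open>By the signed Leibniz rule the brackets of \<open>y\<close> with the single letters add
  up to its supercommutator with the word.\<close>

lemma sum_der_bracket:
  assumes "finite X" "fst ` set z \<subseteq> X"
  shows "(\<Sum>x\<in>X. der (\<lambda>g. ev (brk y g)) (ksign y) x z) =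
    rep y * repw (map snd z) - scal (sgnprod (ksign y) (map snd z)) * (repw (map snd z) * rep y)"
  using assms(2)
proof (induction z)
  case Nil
  then show ?case by (simp add: scal_hom)
next
  case (Cons p z)
  obtain c g where p: "p = (c, g)" by force
  have IH: "(\<Sum>x\<in>X. der (\<lambda>g. ev (brk y g)) (ksign y) x z) =
      rep y * repw (map snd z) - scal (sgnprod (ksign y) (map snd z)) * (repw (map snd z) * rep y)"
    using Cons by simp
  have step: "(\<Sum>x\<in>X. der (\<lambda>g. ev (brk y g)) (ksign y) x (p # z)) =
      ev (brk y g) * repw (map snd z) +
      scal (ksign y g) * rep g * (\<Sum>x\<in>X. der (\<lambda>g. ev (brk y g)) (ksign y) x z)"
    using Cons.prems assms(1) by (simp add: p sum.distrib sum_distrib_left)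
  show ?case
    unfolding step IH by (simp add: p ev_brk algebra_simps scal_collect rep_scal)
qed

text \<open>Invariance of the form, with the two ends of the chord separated by \<open>M\<close>.\<close>

lemma chord_invariance:
  "(\<Sum>g\<in>UNIV. \<Sum>h\<in>UNIV. scal (Cc g h * sgnprod (ksign g) v) *
     (ev (brk y g) * M * rep h + scal (ksign y g * sgnprod (ksign y) v) * (rep g * M * ev (brk y h)))) = 0"
proof -
  define s where "s = sgnprod (ksign Qp) v"
  \<comment> \<open>The word \<open>v\<close> between the ends enters only through its sign, so a
    matrix check for each \<open>y\<close> and each of the two signs suffices.\<close>
  have s: "s = 1 \<or> s = -1" using sgnprod_ksign_cases s_def by auto
  have sgn: "sgnprod (ksign g) v = (if godd g then s else 1)" for g
    unfolding s_def by (rule sgnprod_ksign)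
  show ?thesis
    unfolding sgn sum_gb
    using s by (cases y)
      (auto simp: ksign_def scal_hom m2_eq_iff algebra_simps)
qed

lemma rep_ev_chords_commute:
  assumes "chord_word w"
  shows "rep y * ev_chords w = ev_chords w * rep y"
proof -
  let ?d = "der (\<lambda>g. ev (brk y g)) (ksign y)"
  have "rep y * ev_chords w - ev_chords w * rep y =
      (\<Sum>l\<in>words (length w). scal (coef (zip w l)) * (rep y * repw l - repw l * rep y))"
    by (simp add: ev_chords_def sum_distrib_left sum_distrib_right sum_subtractf rep_scal
        right_diff_distrib mult.assoc)
  also have "\<dots> = (\<Sum>l\<in>words (length w). scal (coef (zip w l)) * (\<Sum>x\<in>set w. ?d x (zip w l)))"
  proof (rule sum.cong[OF refl])
    fix l assume "l \<in> words (length w)"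
    note l = length_words[OF this]
    have "(\<Sum>x\<in>set w. ?d x (zip w l)) = rep y * repw l - scal (sgnprod (ksign y) l) * (repw l * rep y)"
      using sum_der_bracket[of "set w" "zip w l" y] l set_zip_leftD[of _ _ w l] by fastforce
    \<comment> \<open>For contributing words the sign is 1, so the supercommutator is the ordinary
      commutator.\<close>
    moreover have "coef (zip w l) = 0 \<or> sgnprod (ksign y) l = 1"
      using coef_nonzero assms l by auto
    ultimately show "scal (coef (zip w l)) * (rep y * repw l - repw l * rep y) =
        scal (coef (zip w l)) * (\<Sum>x\<in>set w. ?d x (zip w l))"
      by (auto simp: scal_hom)
  qed
  also have "\<dots> = (\<Sum>x\<in>set w. \<Sum>l\<in>words (length w). scal (coef (zip w l)) * ?d x (zip w l))"
    unfolding sum_distrib_left by (rule sum.swap)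
  also have "\<dots> = 0"
  proof (rule sum.neutral, rule ballI)
    fix x assume "x \<in> set w"
    then obtain A B D where "w = A @ x # B @ x # D" "x \<notin> set A" "x \<notin> set B" "x \<notin> set D"
      using chord_split assms by blast
    from sum_der[OF this] show "(\<Sum>l\<in>words (length w). scal (coef (zip w l)) * ?d x (zip w l)) = 0"
      by (simp add: chord_invariance)
  qed
  finally show ?thesis by simp
qed

text \<open>Commuting with \<open>Qp\<close> kills the upper right entry and equates the diagonal
  ones; commuting with \<open>G\<close> kills the lower left one.\<close>

lemma ev_chords_scalar:
  assumes "chord_word w"
  shows "ev_chords w = sc (e11 (ev_chords w))"
  using rep_ev_chords_commute[OF assms, of Qp] rep_ev_chords_commute[OF assms, of G]
  by (simp add: m2_eq_iff algebra_simps)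

section \<open>Deleting chords as a derivative\<close>

definition dvb :: "complex poly poly m2 \<Rightarrow> complex poly poly m2" where
  "dvb m = M2 (pderiv (e11 m)) (pderiv (e12 m)) (pderiv (e21 m)) (pderiv (e22 m))"

lemma dvb_sel [simp]: "e11 (dvb m) = pderiv (e11 m)" "e12 (dvb m) = pderiv (e12 m)"
  "e21 (dvb m) = pderiv (e21 m)" "e22 (dvb m) = pderiv (e22 m)"
  by (simp_all add: dvb_def)

lemma dvb_add: "dvb (m + n) = dvb m + dvb n"
  by (simp add: m2_eq_iff pderiv_add)

lemma dvb_0: "dvb 0 = 0"
  by (simp add: m2_eq_iff)

lemma dvb_sum: "dvb (sum f A) = (\<Sum>x\<in>A. dvb (f x))"
  by (induction A rule: infinite_finite_induct) (simp_all add: dvb_0 dvb_add)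

lemma dvb_mult: "dvb (m * n) = dvb m * n + m * dvb n"
  by (simp add: m2_eq_iff pderiv_add pderiv_mult algebra_simps)

lemma pderiv_const_mult: "pderiv ([:c:] * p) = [:c:] * pderiv p"
  by (simp add: pderiv_smult)

lemma dvb_scal: "dvb (scal k * m) = scal k * dvb m"
  by (simp add: m2_eq_iff scal_def pderiv_smult)

lemma dvb_rep: "dvb (rep g) = (if g = G then 1 else 0)"
  by (cases g) (simp_all add: m2_eq_iff va_def vb_def pderiv_pCons one_pCons pderiv_add)

lemma sgnprod_one: "sgnprod (\<lambda>_. 1) u = 1"
  by (induction u) simp_all

text \<open>Among the letters only \<open>G\<close> depends on b, with the identity matrix as
  derivative; without signs this is the ordinary Leibniz rule.\<close>

lemma sum_der_dvb:
  assumes "finite X" "fst ` set z \<subseteq> X"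
  shows "(\<Sum>x\<in>X. der (\<lambda>g. if g = G then 1 else 0) (\<lambda>_. 1) x z) = dvb (repw (map snd z))"
  using assms(2)
proof (induction z)
  case Nil
  then show ?case by (simp add: m2_eq_iff)
next
  case (Cons p z)
  obtain c g where p: "p = (c, g)" by force
  let ?d = "der (\<lambda>g. if g = G then 1 else 0) (\<lambda>_. 1)"
  have IH: "(\<Sum>x\<in>X. ?d x z) = dvb (repw (map snd z))" using Cons by simp
  have step: "(\<Sum>x\<in>X. ?d x (p # z)) =
      (if g = G then 1 else 0) * repw (map snd z) + scal 1 * rep g * (\<Sum>x\<in>X. ?d x z)"
    using Cons.prems assms(1) by (simp add: p sum.distrib sum_distrib_left)
  show ?case unfolding step IH by (simp add: p dvb_mult dvb_rep scal_hom)
qed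

text \<open>Differentiating in \<open>vb\<close>, i.e. along the automorphisms fixing \<open>H\<close>, \<open>Q\<^sub>\<plusminus>\<close> and shifting
  \<open>G\<close> by a multiple of the central \<open>H\<close>, turns a chord into a central factor.\<close>

lemma chord_derivative:
  "(\<Sum>g\<in>UNIV. \<Sum>h\<in>UNIV. scal (Cc g h * sgnprod (ksign g) v) *
     ((if g = G then 1 else 0) * M * rep h + scal (1 * sgnprod (\<lambda>_. 1) v) *
       (rep g * M * (if h = G then 1 else 0)))) = sc (2 * va) * M"
proof -
  have sgn: "sgnprod (ksign g) v = (if godd g then sgnprod (ksign Qp) v else 1)" for g
    by (rule sgnprod_ksign)
  have "sgnprod (ksign H) v = 1" "sgnprod (ksign G) v = 1"
    by (simp_all add: sgn[of H] sgn[of G])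
  then show ?thesis
    by (simp add: sum_gb sgnprod_one scal_hom m2_eq_iff algebra_simps)
qed

lemma ev_chords_append_words:
  "ev_chords (A @ B) = (\<Sum>u\<in>words (length A). \<Sum>v\<in>words (length B).
     scal (coef (zip (A @ B) (u @ v))) * (repw u * repw v))"
  by (simp add: ev_chords_def sum_words_append)

text \<open>The Leibniz terms are sorted by chords. A chord contributes through its labellings
  \<open>G\<close>, \<open>H\<close> and \<open>H\<close>, \<open>G\<close>, each leaving a factor a
  and the diagram without that chord.\<close>

lemma dvb_ev_chords:
  assumes "chord_word w"
  shows "dvb (ev_chords w) = sc (2 * va) * (\<Sum>x\<in>set w. ev_chords (filter (\<lambda>y. y \<noteq> x) w))"
proof -
  let ?d = "der (\<lambda>g. if g = G then 1 else 0) (\<lambda>_. 1)"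
  have "dvb (ev_chords w) = (\<Sum>l\<in>words (length w). scal (coef (zip w l)) * dvb (repw l))"
    by (simp add: ev_chords_def dvb_sum dvb_scal)
  also have "\<dots> = (\<Sum>l\<in>words (length w). scal (coef (zip w l)) * (\<Sum>x\<in>set w. ?d x (zip w l)))"
  proof (rule sum.cong[OF refl])
    fix l assume "l \<in> words (length w)"
    note l = length_words[OF this]
    have "(\<Sum>x\<in>set w. ?d x (zip w l)) = dvb (repw l)"
      using sum_der_dvb[of "set w" "zip w l"] l set_zip_leftD[of _ _ w l] by fastforce
    then show "scal (coef (zip w l)) * dvb (repw l) =
        scal (coef (zip w l)) * (\<Sum>x\<in>set w. ?d x (zip w l))"
      by simp
  qed
  also have "\<dots> = (\<Sum>x\<in>set w. \<Sum>l\<in>words (length w). scal (coef (zip w l)) * ?d x (zip w l))"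
    unfolding sum_distrib_left by (rule sum.swap)
  also have "\<dots> = (\<Sum>x\<in>set w. sc (2 * va) * ev_chords (filter (\<lambda>y. y \<noteq> x) w))"
  proof (rule sum.cong[OF refl])
    fix x assume "x \<in> set w"
    then obtain A B D where w: "w = A @ x # B @ x # D" "x \<notin> set A" "x \<notin> set B" "x \<notin> set D"
      using chord_split assms by blast
    have "sc (2 * va) * ev_chords (filter (\<lambda>y. y \<noteq> x) w) = sc (2 * va) * ev_chords (A @ B @ D)"
      unfolding w(1) filter_neq_split[OF w(2-4)] by (rule refl)
    also have "\<dots> = (\<Sum>u\<in>words (length A). \<Sum>v\<in>words (length B). \<Sum>t\<in>words (length D).
        sc (2 * va) * (scal (coef (zip (A @ B @ D) (u @ v @ t))) * (repw u * (repw v * repw t))))"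
      by (simp add: ev_chords_def sum_words_append sum_distrib_left)
    also have "\<dots> = (\<Sum>l\<in>words (length w). scal (coef (zip w l)) * ?d x (zip w l))"
      unfolding sum_der[OF w] chord_derivative
      by (simp add: sgnprod_one sc_left_commute mult.assoc)
    finally show "(\<Sum>l\<in>words (length w). scal (coef (zip w l)) * ?d x (zip w l)) =
        sc (2 * va) * ev_chords (filter (\<lambda>y. y \<noteq> x) w)" by (rule sym)
  qed
  finally show ?thesis by (simp add: sum_distrib_left)
qed

section \<open>Linear combinations of chord diagrams\<close>

definition ev_comb :: "lcomb \<Rightarrow> complex poly poly m2" where
  "ev_comb L = sum_list (map (\<lambda>(k, w). scal k * ev_chords w) L)"

lemma ev_comb_simps [simp]: "ev_comb [] = 0" "ev_comb ((k, w) # L) = scal k * ev_chords w + ev_comb L"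
  "ev_comb (L @ L') = ev_comb L + ev_comb L'"
  by (simp_all add: ev_comb_def)

lemma ev_comb_concat: "ev_comb (concat Ls) = sum_list (map ev_comb Ls)"
  by (induction Ls) simp_all

lemma WL_fsupp_ev: "fsupp (WL L) \<and> ev (WL L) = ev_comb L"
  by (induction L) (auto simp: WL_def ev_Wt)

lemma ev_comb_scale: "ev_comb (map (\<lambda>(k', v). (k * k', v)) L) = scal k * ev_comb L"
  by (induction L) (auto simp: scal_hom distrib_left mult.assoc)

lemma ev_comb_sdiag: "ev_comb (sdiag w) = (\<Sum>x\<in>set w. ev_chords (filter (\<lambda>y. y \<noteq> x) w))"
  by (simp add: ev_comb_def sdiag_def sum.set_conv_list comp_def scal_hom)

lemma ev_comb_slin: "ev_comb (slin L) = sum_list (map (\<lambda>(k, w). scal k * ev_comb (sdiag w)) L)"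
  by (simp add: slin_def ev_comb_concat comp_def case_prod_unfold ev_comb_scale[unfolded case_prod_unfold])

definition chord_comb :: "lcomb \<Rightarrow> bool" where
  "chord_comb L \<longleftrightarrow> (\<forall>(k, w)\<in>set L. chord_word w)"

lemma chord_comb_slin: "chord_comb L \<Longrightarrow> chord_comb (slin L)"
  by (fastforce simp: chord_comb_def slin_def sdiag_def chord_word_filter)

lemma dvb_ev_comb: "chord_comb L \<Longrightarrow> dvb (ev_comb L) = sc (2 * va) * ev_comb (slin L)"
proof (induction L)
  case Nil
  then show ?case by (simp add: dvb_0 ev_comb_slin)
next
  case (Cons p L)
  obtain k w where p: "p = (k, w)" by force
  then show ?case using Cons
    by (simp add: chord_comb_def ev_comb_slin dvb_add dvb_scal dvb_ev_chords ev_comb_sdiag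
        distrib_left sc_left_commute)
qed

lemma ev_comb_scalar: "chord_comb L \<Longrightarrow> ev_comb L = sc (e11 (ev_comb L))"
proof (induction L)
  case (Cons p L)
  obtain k w where p: "p = (k, w)" by force
  then have "ev_chords w = sc (e11 (ev_chords w))" "ev_comb L = sc (e11 (ev_comb L))"
    using Cons ev_chords_scalar by (auto simp: chord_comb_def)
  then show ?case by (simp add: p m2_eq_iff scal_def)
qed (simp add: m2_eq_iff)

lemma pderiv_ev_comb:
  assumes "chord_comb L"
  shows "(pderiv ^^ k) (e11 (ev_comb L)) = (2 * va) ^ k * e11 (ev_comb ((slin ^^ k) L))"
proof (induction k)
  case (Suc k)
  have "chord_comb ((slin ^^ k) L)" by (induction k) (simp_all add: assms chord_comb_slin)
  then have "dvb (ev_comb ((slin ^^ k) L)) = sc (2 * va) * ev_comb ((slin ^^ Suc k) L)"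
    by (simp add: dvb_ev_comb)
  then have "pderiv (e11 (ev_comb ((slin ^^ k) L))) = 2 * va * e11 (ev_comb ((slin ^^ Suc k) L))"
    by (simp add: m2_eq_iff)
  \<comment> \<open>This factor is constant in b, so the derivative passes it.\<close>
  moreover have "(2 * va) ^ k = [:[:0, 2:] ^ k:]"
    by (induction k) (simp_all add: va_def pCons_one numeral_poly mult_ac)
  ultimately show ?case using Suc by (simp add: pderiv_smult) 
qed simp

section \<open>Connected sum with isolated chords\<close>

definition casimir :: "complex poly poly" where "casimir = va * (2 * vb + 1)"

lemma coef_map_strict_mono:
  assumes "strict_mono f"
  shows "coef (map (\<lambda>(x, g). (f x, g)) z) = coef z"
proof -
  have "pair_factor (f x, g) (f y, h) = pair_factor (x, g) (y, h)" for x y g h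
    using assms by (simp add: pair_factor_def strict_mono_eq strict_mono_less)
  then have "pair_factor (f x, g) \<circ> (\<lambda>(x, g). (f x, g)) = pair_factor (x, g)" for x g
    by auto
  then show ?thesis by (induction z) auto
qed

lemma ev_chords_map_strict_mono:
  assumes "strict_mono f"
  shows "ev_chords (map f w) = ev_chords w"
  by (simp add: ev_chords_def zip_map1 coef_map_strict_mono[OF assms])

lemma coef_append_less:
  assumes "\<forall>p\<in>set z. \<forall>q\<in>set z'. fst p < fst q"
  shows "coef (z @ z') = coef z * coef z'"
proof -
  have "prod_list (map (pair_factor p) z') = 1" if "\<forall>q\<in>set z'. fst p < fst q" for p
    using that by (induction z') (auto simp: pair_factor_def)
  then have "prod_list (map (\<lambda>p. prod_list (map (pair_factor p) z')) z) = 1"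
    using assms by (induction z) auto
  then show ?thesis by (simp add: coef_append)
qed

text \<open>No pair across the cut is contracted or inverted, so the coefficients factor along with
  the words.\<close>

lemma ev_chords_append:
  assumes "\<forall>x\<in>set A. \<forall>y\<in>set B. x < y"
  shows "ev_chords (A @ B) = ev_chords A * ev_chords B"
proof -
  have "coef (zip (A @ B) (u @ v)) = coef (zip A u) * coef (zip B v)"
    if "u \<in> words (length A)" for u v
  proof -
    have "\<forall>p\<in>set (zip A u). \<forall>q\<in>set (zip B v). fst p < fst q"
      using assms by (auto dest!: set_zip_leftD)
    then show ?thesis using length_words[OF that] by (simp add: coef_append_less)
  qed
  then show ?thesis
    unfolding ev_chords_append_words
    by (simp add: ev_chords_def sum_product scal_hom mult.assoc scal_left_commute[of "repw _"])
qed

lemma ev_chords_chord: "ev_chords [i, i] = sc casimir"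
  by (simp add: ev_chords_def sum_words_Suc sum_words_0 sum_gb pair_factor_def m2_eq_iff scal_hom casimir_def
      algebra_simps)

text \<open>The isolated chords use labels below \<open>k\<close> and the shifted diagram uses
  labels from \<open>k\<close> on, so \<open>ev_chords_append\<close> applies; each isolated chord
  contributes \<open>casimir\<close>.\<close>

lemma ev_chords_theta_sum: "ev_chords (theta_sum k w) = sc (casimir ^ k) * ev_chords w"
proof -
  have "ev_chords (concat (map (\<lambda>i. [i, i]) [0..<k])) = sc (casimir ^ k)"
  proof (induction k)
    case 0
    then show ?case by (simp add: ev_chords_def sum_words_0 scal_hom sc_hom)
  next
    case (Suc k)
    have "ev_chords (concat (map (\<lambda>i. [i, i]) [0..<Suc k])) =
        ev_chords (concat (map (\<lambda>i. [i, i]) [0..<k])) * ev_chords [k, k]"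
      by (simp only: upt_Suc_append le0 map_append concat_append)
        (subst ev_chords_append[symmetric], auto)
    then show ?case using Suc by (simp add: ev_chords_chord sc_hom mult.commute[of casimir])
  qed
  moreover have "ev_chords (theta_sum k w) =
      ev_chords (concat (map (\<lambda>i. [i, i]) [0..<k])) * ev_chords (map (\<lambda>x. x + k) w)"
    unfolding theta_sum_def by (rule ev_chords_append) auto
  ultimately show ?thesis by (simp add: ev_chords_map_strict_mono strict_mono_def)
qed

lemma ev_comb_psi:
  "ev_comb (psi w) = (\<Sum>k\<le>length w. scal ((-1) ^ k / fact k) * sc (casimir ^ k) *
    ev_comb ((slin ^^ k) [(1, w)]))"
proof -
  have "ev_comb (map (\<lambda>(a, v). (c * a, theta_sum k v)) L) = scal c * sc (casimir ^ k) * ev_comb L" for c k L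
    by (induction L)
      (auto simp: ev_chords_theta_sum scal_hom distrib_left mult.assoc scal_left_commute[of "sc _"])
  then have "ev_comb (psi w) = sum_list (map (\<lambda>k. scal ((-1) ^ k / fact k) * sc (casimir ^ k) *
      ev_comb ((slin ^^ k) [(1, w)])) [0..<Suc (length w)])"
    by (simp only: psi_def ev_comb_concat map_map comp_def)
  also have "\<dots> = (\<Sum>k\<in>set [0..<Suc (length w)]. scal ((-1) ^ k / fact k) * sc (casimir ^ k) *
      ev_comb ((slin ^^ k) [(1, w)]))"
    by (rule sum_list_distinct_conv_sum_set) simp
  also have "set [0..<Suc (length w)] = {..length w}" by auto
  finally show ?thesis .
qed

section \<open>Taylor expansion\<close>

lemma higher_pderiv_eq_0:
  fixes p :: "'a :: {comm_semiring_1, semiring_no_zero_divisors, semiring_char_0} poly"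
  assumes "degree p \<le> n"
  shows "(pderiv ^^ Suc n) p = 0"
  using assms
proof (induction n arbitrary: p)
  case 0
  then show ?case by (simp add: pderiv_eq_0_iff)
next
  case (Suc n)
  then have "(pderiv ^^ Suc n) (pderiv p) = 0" by (simp add: degree_pderiv)
  then show ?case by (simp add: funpow_swap1)
qed

text \<open>The derivative of the truncated Taylor series telescopes, so the series is constant.\<close>

lemma taylor_const:
  fixes F :: "complex poly poly"
  assumes "degree F \<le> N"
  shows "(\<Sum>k\<le>N. [:[:(-1) ^ k / fact k:]:] * [:[:-c:], 1:] ^ k * (pderiv ^^ k) F) = [:poly F [:c:]:]"
proof -
  let ?s = "[:[:-c:], 1:] :: complex poly poly"
  let ?T = "\<lambda>N. \<Sum>k\<le>N. [:[:(-1) ^ k / fact k:]:] * ?s ^ k * (pderiv ^^ k) F"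
  \<comment> \<open>Only the derivative falling on the top term's factor
    \<open>(pderiv ^^ N) F\<close> survives; it vanishes once \<open>N\<close> reaches the degree of
    \<open>F\<close>.\<close>
  have "pderiv (?T N) = [:[:(-1) ^ N / fact N:]:] * ?s ^ N * (pderiv ^^ Suc N) F" for N
  proof (induction N)
    case 0
    then show ?case by (simp add: pCons_one)
  next
    case (Suc N)
    have coeff: "[:[:(-1) ^ Suc N / fact (Suc N):]:] * of_nat (Suc N) =
        (- [:[:(-1) ^ N / fact N:]:] :: complex poly poly)"
      by (simp add: of_nat_poly field_simps del: of_nat_Suc)
    have "pderiv (?s ^ Suc N) = of_nat (Suc N) * ?s ^ N"
      by (simp add: pderiv_power_Suc pderiv_pCons of_nat_poly del: power_Suc of_nat_Suc)
    then have "pderiv ([:[:(-1) ^ Suc N / fact (Suc N):]:] * ?s ^ Suc N) =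
        - ([:[:(-1) ^ N / fact N:]:] * ?s ^ N)"
      unfolding pderiv_const_mult by (simp only: mult.assoc[symmetric] coeff mult_minus_left)
    moreover have "pderiv (a * x) = a * pderiv x - b * x" if "pderiv a = - b"
      for a b x :: "complex poly poly"
      using that by (simp add: pderiv_mult mult.commute)
    ultimately have "pderiv ([:[:(-1) ^ Suc N / fact (Suc N):]:] * ?s ^ Suc N * (pderiv ^^ Suc N) F) =
        [:[:(-1) ^ Suc N / fact (Suc N):]:] * ?s ^ Suc N * pderiv ((pderiv ^^ Suc N) F) -
        [:[:(-1) ^ N / fact N:]:] * ?s ^ N * (pderiv ^^ Suc N) F"
      by blast
    then show ?case
      unfolding sum.atMost_Suc pderiv_add Suc funpow.simps(2)[of "Suc N"] comp_apply
      by (simp only: add_diff_cancel_left' add_diff_eq)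
  qed
  then have "pderiv (?T N) = 0" using higher_pderiv_eq_0[OF assms] by simp
  then have "degree (?T N) = 0" by (simp add: pderiv_eq_0_iff)
  then obtain t where t: "?T N = [:t:]" by (rule degree_eq_zeroE)
  \<comment> \<open>Evaluation at the root of \<open>?s\<close> kills every term but the zeroth and
    so identifies the constant.\<close>
  have "poly (?T N) [:c:] = (\<Sum>k\<le>N. if k = 0 then poly F [:c:] else 0)"
    unfolding poly_sum by (rule sum.cong) (auto simp: pCons_one)
  then have "t = poly F [:c:]" unfolding t by simp
  then show ?thesis using t by simp
qed

section \<open>Membership in the algebra generated by the central elements\<close>

text \<open>A power of a is weighed against the degree in b of the cofactor; for d at most k such
  polynomials lie in the algebra generated by a and ab.\<close>

definition weight_bound :: "nat \<Rightarrow> nat \<Rightarrow> complex poly poly \<Rightarrow> bool" where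
  "weight_bound k d f \<longleftrightarrow> (\<exists>q. f = va ^ k * q \<and> degree q \<le> d)"

lemma weight_bound_0: "weight_bound k d 0"
  unfolding weight_bound_def by (rule exI[of _ 0]) simp

lemma weight_bound_va: "weight_bound k d f \<Longrightarrow> weight_bound (Suc k) d (va * f)"
  by (auto simp: weight_bound_def mult.assoc)

lemma weight_bound_linear:
  assumes "weight_bound k d f" "degree r \<le> 1"
  shows "weight_bound k (Suc d) (r * f)"
proof -
  obtain q where q: "f = va ^ k * q" "degree q \<le> d" using assms(1) by (auto simp: weight_bound_def)
  have "degree (r * q) \<le> Suc d" using degree_mult_le[of r q] q(2) assms(2) by linarith
  then show ?thesis using q(1) by (auto simp: weight_bound_def intro!: exI[of _ "r * q"])
qed

text \<open>Each \<open>H\<close> or \<open>Qm\<close> yields a factor a or a zero entry, each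
  \<open>G\<close> raises the degree in b by at most one, and \<open>Qp\<close> does
  neither.\<close>

lemma weight_bound_repw:
  defines "P u \<equiv> weight_bound (count_list u H + count_list u Qm) (count_list u G)"
  shows "P u (e11 (repw u)) \<and> P u (e12 (repw u)) \<and> P u (e21 (repw u)) \<and> P u (e22 (repw u))"
proof (induction u)
  case Nil
  have "weight_bound 0 0 1" unfolding weight_bound_def by (rule exI[of _ 1]) simp
  then show ?case by (simp add: P_def weight_bound_0)
next
  case (Cons x u)
  have "degree vb \<le> 1" "degree (vb + 1) \<le> 1"
    by (simp_all add: vb_def degree_add_le)
  then show ?case using Cons
    by (cases x) (simp_all add: P_def weight_bound_0 weight_bound_va weight_bound_linear)
qed

lemma va_power: "va ^ k = [:[:0, 1:] ^ k:]"
  using monom_eq_va_vb[of k 0] by (simp add: monom_altdef)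

text \<open>For i at most k, a^k b^i equals a^(k-i) (ab)^i, and ab is a polynomial in a and the
  scalar of c.\<close>

lemma weight_bound_image:
  assumes "weight_bound k d f" "d \<le> k"
  shows "f \<in> range (\<lambda>p. pcompose p casimir)"
proof -
  obtain q where q: "f = va ^ k * q" "degree q \<le> d" using assms(1) by (auto simp: weight_bound_def)
  \<comment> \<open>This solves \<open>casimir\<close> = 2ab + a for ab, with the outer variable
    standing for \<open>casimir\<close>.\<close>
  define P :: "complex poly poly" where "P = [:[:0, -1/2:], [:1/2:]:]"
  have ab: "pcompose P casimir = va * vb"
    by (simp add: P_def pcompose_pCons casimir_def va_def vb_def numeral_poly one_pCons)
  have "f = (\<Sum>i\<le>degree q. va ^ k * ([:coeff q i:] * vb ^ i))"
    unfolding q(1) sum_distrib_left[symmetric]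
    by (subst poly_as_sum_of_monoms[of q, symmetric]) (simp add: vb_def monom_altdef)
  also have "\<dots> = (\<Sum>i\<le>degree q. pcompose ([:coeff q i * [:0, 1:] ^ (k - i):] * P ^ i) casimir)"
  proof (rule sum.cong[OF refl])
    fix i assume "i \<in> {..degree q}"
    then have k: "va ^ k = va ^ (k - i) * va ^ i" using q(2) assms(2) by (simp flip: power_add)
    have c: "[:coeff q i * [:0, 1:] ^ (k - i):] = [:coeff q i:] * va ^ (k - i)"
      by (simp add: va_power)
    have "va ^ k * ([:coeff q i:] * vb ^ i) = ([:coeff q i:] * va ^ (k - i)) * (va * vb) ^ i"
      unfolding k power_mult_distrib by (simp only: mult_ac)
    also have "\<dots> = pcompose ([:coeff q i * [:0, 1:] ^ (k - i):] * P ^ i) casimir"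
      unfolding pcompose_mult pcompose_power pcompose_const ab by (simp only: c)
    finally show "va ^ k * ([:coeff q i:] * vb ^ i) =
        pcompose ([:coeff q i * [:0, 1:] ^ (k - i):] * P ^ i) casimir" .
  qed
  also have "\<dots> = pcompose (\<Sum>i\<le>degree q. [:coeff q i * [:0, 1:] ^ (k - i):] * P ^ i) casimir"
    by (rule pcompose_sum[symmetric])
  finally show ?thesis by (rule range_eqI)
qed

lemma range_pcompose_sum:
  assumes "\<And>x. x \<in> A \<Longrightarrow> f x \<in> range (\<lambda>p. pcompose p q)"
  shows "sum f A \<in> range (\<lambda>p. pcompose p q)"
proof -
  have "\<forall>x\<in>A. \<exists>p. f x = pcompose p q" using assms by auto
  then obtain g where "\<forall>x\<in>A. f x = pcompose (g x) q" by metis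
  then have "sum f A = pcompose (sum g A) q" by (simp add: pcompose_sum)
  then show ?thesis by blast
qed

lemma ev_chords_image:
  assumes "chord_word w"
  shows "e11 (ev_chords w) \<in> range (\<lambda>p. pcompose p casimir)"
proof -
  have "[:[:coef (zip w l):]:] * e11 (repw l) \<in> range (\<lambda>p. pcompose p casimir)"
    if "l \<in> words (length w)" for l
  proof (cases "coef (zip w l) = 0")
    case True
    then show ?thesis by (intro image_eqI[of _ _ 0]) simp_all
  next
    case False
    then have "count_list l G \<le> count_list l H + count_list l Qm"
      using coef_nonzero[OF assms length_words[OF that]] by blast
    then obtain p where "e11 (repw l) = pcompose p casimir"
      using weight_bound_image weight_bound_repw by blast
    then have "[:[:coef (zip w l):]:] * e11 (repw l) =
        pcompose (smult [:coef (zip w l):] p) casimir"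
      by (simp add: pcompose_smult)
    then show ?thesis by blast
  qed
  then show ?thesis
    by (simp add: ev_chords_def scal_def range_pcompose_sum del: mult_pCons_left)
qed

text \<open>The degree in b is at most the number of \<open>G\<close>. The bound is the order at
  which \<open>psi\<close> is truncated, so the Taylor series is complete.\<close>

lemma degree_ev_chords: "degree (e11 (ev_chords w)) \<le> length w"
proof -
  have "degree ([:[:coef (zip w l):]:] * e11 (repw l)) \<le> length w" if "l \<in> words (length w)" for l
  proof -
    obtain k q where q: "e11 (repw l) = va ^ k * q" "degree q \<le> count_list l G"
      using weight_bound_repw[of l] by (auto simp: weight_bound_def)
    have "degree (e11 (repw l)) \<le> degree q"
      unfolding q(1) va_power by (simp add: degree_smult_le)
    moreover have "count_list l G \<le> length l" by (rule count_le_length)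
    moreover have "degree ([:[:coef (zip w l):]:] * e11 (repw l)) \<le> degree (e11 (repw l))"
      by (simp add: degree_smult_le)
    ultimately show ?thesis using length_words[OF that] q(2) by linarith
  qed
  then show ?thesis by (simp add: ev_chords_def scal_def degree_sum_le del: mult_pCons_left)
qed

section \<open>Values of h, c and polynomials in them\<close>

lemma cU_eq: "cU = tsumset (\<lambda>(x, y). tscale (Cc x y) (tmono [x, y])) UNIV"
proof
  fix w
  have "tsumset (\<lambda>(x, y). tscale (Cc x y) (tmono [x, y])) UNIV w =
      (\<Sum>x\<in>UNIV. \<Sum>y\<in>UNIV. Cc x y * tmono [x, y] w)"
    by (simp add: tsumset_def tscale_def case_prod_unfold sum.cartesian_product UNIV_Times_UNIV)
  also have "\<dots> = cU w"
  proof (cases "\<exists>x y. w = [x, y]")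
    case True
    then obtain x y where "w = [x, y]" by blast
    then show ?thesis by (cases x; cases y) (simp_all add: sum_gb cU_def tmono_def)
  next
    case False
    then show ?thesis by (auto simp: cU_def tmono_def split: list.splits)
  qed
  finally show "cU w = tsumset (\<lambda>(x, y). tscale (Cc x y) (tmono [x, y])) UNIV w" ..
qed

instance gb :: finite
  by standard (simp add: UNIV_gb)

lemma fsupp_cU [simp]: "fsupp cU"
  unfolding cU_eq by (rule fsupp_tsumset) auto

lemma ev_cU: "ev cU = sc casimir"
proof -
  have "ev cU = (\<Sum>x\<in>UNIV. \<Sum>y\<in>UNIV. scal (Cc x y) * (rep x * rep y))"
    unfolding cU_eq
    by (subst ev_tsumset) (auto simp: case_prod_unfold sum.cartesian_product UNIV_Times_UNIV)
  also have "\<dots> = sc casimir"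
    by (simp add: sum_gb m2_eq_iff scal_hom casimir_def algebra_simps)
  finally show ?thesis .
qed

lemma fsupp_hU [simp]: "fsupp hU"
  by (simp add: hU_def)

lemma ev_hU: "ev hU = sc va"
  by (simp add: hU_def m2_eq_iff)

lemma fsupp_evh [simp]: "fsupp (evh q)"
  unfolding evh_def by (rule fsupp_tsumset) simp_all

lemma ev_evh: "ev (evh q) = sc [:q:]"
proof -
  have "ev (evh q) = sc (\<Sum>j\<le>degree q. [:[:coeff q j:]:] * va ^ j)"
    unfolding evh_def
    by (subst ev_tsumset) (simp_all add: ev_hU scal_def sc_sum sc_hom sc_power del: mult_pCons_left)
  also have "(\<Sum>j\<le>degree q. [:[:coeff q j:]:] * va ^ j) = (\<Sum>j\<le>degree q. [:monom (coeff q j) j:])"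
  proof (rule sum.cong[OF refl])
    show "[:[:coeff q j:]:] * va ^ j = [:monom (coeff q j) j:]" for j
      by (simp add: va_power monom_altdef)
  qed
  also have "\<dots> = [:\<Sum>j\<le>degree q. monom (coeff q j) j:]"
  proof -
    have "(\<Sum>j\<in>A. [:f j:]) = [:sum f A:]" for f :: "nat \<Rightarrow> complex poly" and A
      by (induction A rule: infinite_finite_induct) simp_all
    then show ?thesis .
  qed
  also have "\<dots> = [:q:]" by (simp add: poly_as_sum_of_monoms)
  finally show ?thesis .
qed

lemma fsupp_evhc [simp]: "fsupp (evhc p)"
  unfolding evhc_def by (rule fsupp_tsumset) simp_all

text \<open>The coefficients of \<open>p\<close>, polynomials in h, become constants in b through h
  = a; the outer variable stands for c and becomes \<open>casimir\<close>.\<close>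

lemma ev_evhc: "ev (evhc p) = sc (pcompose p casimir)"
proof -
  have "pcompose p casimir = pcompose (\<Sum>i\<le>degree p. monom (coeff p i) i) casimir"
    by (simp add: poly_as_sum_of_monoms)
  also have "\<dots> = (\<Sum>i\<le>degree p. [:coeff p i:] * casimir ^ i)"
    by (simp add: pcompose_sum monom_altdef pcompose_smult pcompose_power pcompose_pCons)
  finally show ?thesis
    unfolding evhc_def
    by (subst ev_tsumset) (simp_all add: ev_evh ev_cU sc_sum sc_hom sc_power del: mult_pCons_left)
qed

section \<open>Deframing as evaluation at b = -1/2\<close>

lemma ev_comb_psi_eq:
  assumes "chord_word w"
  shows "ev_comb (psi w) = sc [:poly (e11 (ev_chords w)) [:-1/2:]:]"
proof -
  let ?L = "[(1, w)] :: lcomb"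
  have L: "chord_comb ?L" using assms by (simp add: chord_comb_def)
  have ev_comb: "ev_comb ?L = ev_chords w" by (simp add: scal_hom)
  have "scal c * sc (casimir ^ k) * ev_comb ((slin ^^ k) ?L) =
      sc ([:[:c:]:] * [:[:-(-1/2):], 1:] ^ k * (pderiv ^^ k) (e11 (ev_chords w)))" for c k
  proof -
    have "chord_comb ((slin ^^ k) ?L)" by (induction k) (simp_all add: L chord_comb_slin)
    note scalar = ev_comb_scalar[OF this]
    \<comment> \<open>The scalar of c is 2a times b + 1/2: the factor (2a)^k turns the k-fold
      deletion into the k-th derivative, and (b + 1/2)^k is the Taylor power for the expansion about
      -1/2.\<close>
    have casimir: "casimir = [:[:-(-1/2):], 1:] * (2 * va)"
      by (simp add: casimir_def va_def vb_def numeral_poly one_pCons)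
    show ?thesis
      using pderiv_ev_comb[OF L, of k] unfolding ev_comb casimir power_mult_distrib
      by (subst scalar) (simp only: scal_def sc_hom(2)[symmetric] mult.assoc)
  qed
  then have "ev_comb (psi w) = sc (\<Sum>k\<le>length w. [:[:(-1) ^ k / fact k:]:] *
      [:[:-(-1/2):], 1:] ^ k * (pderiv ^^ k) (e11 (ev_chords w)))"
    unfolding ev_comb_psi by (simp add: sc_sum)
  then show ?thesis unfolding taylor_const[OF degree_ev_chords] .
qed

text \<open>The existence half keeps the claim about all \<open>p\<close> from holding vacuously;
  the coefficient of c^0 is the value at c = 0.\<close>

theorem theorem3p4:
  fixes w :: "nat list"
  assumes "chord_word w"
  shows "(\<exists>p. ueq (Wt w) (evhc p)) \<and>
         (\<forall>p. ueq (Wt w) (evhc p) \<longrightarrow> ueq (WL (psi w)) (evh (coeff p 0)))"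
proof (intro conjI allI impI)
  \<comment> \<open>Both sides act by scalars, so by faithfulness equality in U is equality of one
    entry.\<close>
  have Wt: "ueq (Wt w) (evhc p) \<longleftrightarrow> e11 (ev_chords w) = pcompose p casimir" for p
    using ev_chords_scalar[OF assms] by (simp add: ueq_iff_ev ev_Wt ev_evhc m2_eq_iff)
  show "\<exists>p. ueq (Wt w) (evhc p)"
    using ev_chords_image[OF assms] unfolding Wt by auto
  fix p assume "ueq (Wt w) (evhc p)"
  then have "e11 (ev_chords w) = pcompose p casimir" by (simp add: Wt)
  \<comment> \<open>Setting b = -1/2 sends c to 0 and leaves a alone, which extracts the constant
    coefficient of \<open>p\<close>.\<close>
  moreover have "poly casimir [:-1/2:] = 0"
    by (simp add: casimir_def va_def vb_def numeral_poly one_pCons)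
  ultimately have "poly (e11 (ev_chords w)) [:-1/2:] = coeff p 0"
    by (simp add: poly_pcompose poly_0_coeff_0)
  then have "ev (WL (psi w)) = ev (evh (coeff p 0))"
    using WL_fsupp_ev ev_comb_psi_eq[OF assms] by (simp add: ev_evh)
  then show "ueq (WL (psi w)) (evh (coeff p 0))"
    using WL_fsupp_ev by (simp add: ueq_iff_ev)
qed

end
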